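(* Suppose $(T;C_1,\dots,C_w)$ forms a $w$-wheel ($w\ge4$) with sectors $S_1,\dots,S_w$ (indices modulo $w$), and let $X$ be any $\kappa$-cut. Then at least one of the following holds: 1. $X=C(i,j)$ for some $i\neq j$; 2. $X\subseteq C(i,i+1)\cup S_i$ for some $i$ (so $X$ is a laminar cut of $C(i,i+1)$); 3. for some $i$, $X$ is a crossing matching cut (in some side, with respect to some nonempty subset) of $C(i,i+1)$ or of $C(i,i+2)$, where that cut has exactly two sides; 4. $X$ is $(\mathrm{I},\kappa-1)$-small; 5. $(T;C_1,\dots,C_w)$ is a small wheel; 6. there exist $i<j$ with $X\subseteq S_i\cup T\cup S_j$ such that $(T;C_1,\dots,C_i,X\cap S_i,C_{i+1},\dots,C_j,X\cap S_j,C_{j+1},\dots,C_w)$ forms a $(w+2)$-wheel; or there exist $i\neq j$ with $X\subseteq S_i\cup T\cup C_j$ such that $(T;C_1,\dots,C_i,X\cap S_i,C_{i+1},\dots,C_w)$ forms a $(w+1)$-wheel.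
   Context: Standing conventions: $G=(V,E)$ is a finite, simple, connected, undirected, non-complete graph with $n=|V|$; $\kappa$ is its vertex connectivity, assumed to satisfy $\kappa<n/4$. A cut is a set $U\subset V$ whose removal disconnects $G$; a $\kappa$-cut is a cut of size $\kappa$; a side of a cut $U$ is a connected component of the subgraph induced on $V\setminus U$. A set $S$ disconnects $P$ from the rest of the graph if $P\ne\emptyset$, $P\cap S=\emptyset$, $V\setminus(S\cup P)\ne\emptyset$ and every path from $P$ to $V\setminus(S\cup P)$ meets $S$. A laminar cut of $U$ in side $P$ is a cut $W\subseteq U\cup P$. A cut with sides $A_1,\dots,A_a$ is $(\mathrm{I},t)$-small if $\sum_{i\neq i^\sharp}|A_i|\le t$ for some index $i^\sharp$. Wheels: for $w\ge4$ (indices modulo $w$), if $V$ is partitioned into pairwise disjoint sets $T,C_1,\dots,C_w,S_1,\dots,S_w$ with all $C_i,S_i$ nonempty ($T$ may be empty) such that for every $i$ the set $C_i\cup T\cup C_{i+2}$ is a $\kappa$-cut that disconnects $S_i\cup C_{i+1}\cup S_{i+1}$ from the rest of the graph, then $(T;C_1,\dots,C_w)$ forms a $w$-wheel with sectors $S_1,\dots,S_w$. $C(i,j)=C_i\cup T\cup C_j$. The wheel is a small wheel if there is an index $i^\sharp$ with $\sum_{i\neq i^\sharp}|S_i|\le\kappa$. Matching cuts: for a cut $U$, a side $A$ of $U$, and $P\subseteq U$, a $\kappa$-cut $W$ is a matching cut of $U$ in side $A$ with respect to $P$ if (i) $U\setminus P\subseteq W\subseteq U\cup A$, (ii) $A\setminus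 W\ne\emptyset$, (iii) $P\cup(V\setminus(U\cup A))$ and $A\setminus W$ are disjoint from $W$ and every path between them meets $W$. If $U$ has exactly two sides $A,B$ and $\emptyset\ne P\subseteq U$, a $\kappa$-cut $W$ is a crossing matching cut of $U$ in side $A$ with respect to $P$ if $W\cap B\neq\emptyset$ and $(U\setminus P)\cup(W\cap A)$ is a matching cut of $U$ in side $A$ with respect to $P$. *)

theory Defs
  imports Main
begin

definition simple_graph :: "'a set \<Rightarrow> ('a \<Rightarrow> 'a \<Rightarrow> bool) \<Rightarrow> bool" where
  "simple_graph V E \<longleftrightarrow> finite V \<and> (\<forall>x y. E x y \<longrightarrow> x \<in> V \<and> y \<in> V)
     \<and> (\<forall>x y. E x y \<longrightarrow> E y x) \<and> (\<forall>x. \<not> E x x)"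

definition reach :: "('a \<Rightarrow> 'a \<Rightarrow> bool) \<Rightarrow> 'a set \<Rightarrow> 'a \<Rightarrow> 'a \<Rightarrow> bool" where
  "reach E S x y \<longleftrightarrow> x \<in> S \<and> y \<in> S \<and> (x, y) \<in> {(a, b). a \<in> S \<and> b \<in> S \<and> E a b}\<^sup>*"

definition graph_connected :: "'a set \<Rightarrow> ('a \<Rightarrow> 'a \<Rightarrow> bool) \<Rightarrow> bool" where
  "graph_connected V E \<longleftrightarrow> V \<noteq> {} \<and> (\<forall>x\<in>V. \<forall>y\<in>V. reach E V x y)"

definition non_complete :: "'a set \<Rightarrow> ('a \<Rightarrow> 'a \<Rightarrow> bool) \<Rightarrow> bool" where
  "non_complete V E \<longleftrightarrow> (\<exists>x\<in>V. \<exists>y\<in>V. x \<noteq> y \<and> \<not> E x y)"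

definition is_cut :: "'a set \<Rightarrow> ('a \<Rightarrow> 'a \<Rightarrow> bool) \<Rightarrow> 'a set \<Rightarrow> bool" where
  "is_cut V E U \<longleftrightarrow> U \<subseteq> V \<and> (\<exists>x\<in>V - U. \<exists>y\<in>V - U. \<not> reach E (V - U) x y)"

text \<open>Vertex connectivity (minimum size of a cut; the graph is non-complete).\<close>
definition kappa :: "'a set \<Rightarrow> ('a \<Rightarrow> 'a \<Rightarrow> bool) \<Rightarrow> nat" where
  "kappa V E = Min {card U | U. is_cut V E U}"

definition kappa_cut :: "'a set \<Rightarrow> ('a \<Rightarrow> 'a \<Rightarrow> bool) \<Rightarrow> 'a set \<Rightarrow> bool" where
  "kappa_cut V E U \<longleftrightarrow> is_cut V E U \<and> card U = kappa V E"

definition sides :: "'a set \<Rightarrow> ('a \<Rightarrow> 'a \<Rightarrow> bool) \<Rightarrow> 'a set \<Rightarrow> 'a set set" where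
  "sides V E U = {A. \<exists>x\<in>V - U. A = {y. reach E (V - U) x y}}"

definition disconnects :: "'a set \<Rightarrow> ('a \<Rightarrow> 'a \<Rightarrow> bool) \<Rightarrow> 'a set \<Rightarrow> 'a set \<Rightarrow> bool" where
  "disconnects V E S P \<longleftrightarrow> P \<noteq> {} \<and> P \<subseteq> V \<and> P \<inter> S = {} \<and> V - (S \<union> P) \<noteq> {}
     \<and> (\<forall>x\<in>P. \<forall>y\<in>V - (S \<union> P). \<not> reach E (V - S) x y)"

definition I_small :: "'a set \<Rightarrow> ('a \<Rightarrow> 'a \<Rightarrow> bool) \<Rightarrow> 'a set \<Rightarrow> nat \<Rightarrow> bool" where
  "I_small V E U t \<longleftrightarrow> (\<exists>A\<in>sides V E U. (\<Sum>B\<in>sides V E U - {A}. card B) \<le> t)"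

text \<open>Wheels. The hub sets C_1..C_w and sectors S_1..S_w are given as lists
Cs, Ss of length w, 0-based: paper C_k is Cs!(k-1), S_k is Ss!(k-1);
indices taken modulo w.\<close>
definition wheel_with_sectors ::
  "'a set \<Rightarrow> ('a \<Rightarrow> 'a \<Rightarrow> bool) \<Rightarrow> 'a set \<Rightarrow> 'a set list \<Rightarrow> 'a set list \<Rightarrow> bool" where
  "wheel_with_sectors V E T Cs Ss \<longleftrightarrow>
     (let w = length Cs in
       length Ss = w \<and> 4 \<le> w
       \<and> (\<forall>i<w. Cs ! i \<noteq> {} \<and> Ss ! i \<noteq> {})
       \<and> T \<union> \<Union>(set Cs) \<union> \<Union>(set Ss) = V
       \<and> (\<forall>i<w. T \<inter> Cs ! i = {} \<and> T \<inter> Ss ! i = {})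
       \<and> (\<forall>i<w. \<forall>j<w. i \<noteq> j \<longrightarrow> Cs ! i \<inter> Cs ! j = {} \<and> Ss ! i \<inter> Ss ! j = {})
       \<and> (\<forall>i<w. \<forall>j<w. Cs ! i \<inter> Ss ! j = {})
       \<and> (\<forall>i<w. kappa_cut V E (Cs ! i \<union> T \<union> Cs ! ((i + 2) mod w))
              \<and> disconnects V E (Cs ! i \<union> T \<union> Cs ! ((i + 2) mod w))
                   (Ss ! i \<union> Cs ! ((i + 1) mod w) \<union> Ss ! ((i + 1) mod w))))"

definition forms_wheel ::
  "'a set \<Rightarrow> ('a \<Rightarrow> 'a \<Rightarrow> bool) \<Rightarrow> 'a set \<Rightarrow> 'a set list \<Rightarrow> bool" where
  "forms_wheel V E T Cs \<longleftrightarrow> (\<exists>Ss. wheel_with_sectors V E T Cs Ss)"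

definition Cij :: "'a set \<Rightarrow> 'a set list \<Rightarrow> nat \<Rightarrow> nat \<Rightarrow> 'a set" where
  "Cij T Cs i j = Cs ! (i mod length Cs) \<union> T \<union> Cs ! (j mod length Cs)"

definition small_wheel :: "'a set list \<Rightarrow> nat \<Rightarrow> bool" where
  "small_wheel Ss k \<longleftrightarrow> (\<exists>i0 < length Ss. (\<Sum>i\<in>{..<length Ss} - {i0}. card (Ss ! i)) \<le> k)"

definition matching_cut ::
  "'a set \<Rightarrow> ('a \<Rightarrow> 'a \<Rightarrow> bool) \<Rightarrow> 'a set \<Rightarrow> 'a set \<Rightarrow> 'a set \<Rightarrow> 'a set \<Rightarrow> bool" where
  "matching_cut V E U A P W \<longleftrightarrow> kappa_cut V E W
     \<and> U - P \<subseteq> W \<and> W \<subseteq> U \<union> A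
     \<and> A - W \<noteq> {}
     \<and> (P \<union> (V - (U \<union> A))) \<inter> W = {} \<and> (A - W) \<inter> W = {}
     \<and> (\<forall>x\<in>P \<union> (V - (U \<union> A)). \<forall>y\<in>A - W. \<not> reach E (V - W) x y)"

definition crossing_matching_cut ::
  "'a set \<Rightarrow> ('a \<Rightarrow> 'a \<Rightarrow> bool) \<Rightarrow> 'a set \<Rightarrow> 'a set \<Rightarrow> 'a set \<Rightarrow> 'a set \<Rightarrow> bool" where
  "crossing_matching_cut V E U A P W \<longleftrightarrow>
     (\<exists>B. sides V E U = {A, B} \<and> A \<noteq> B
        \<and> P \<noteq> {} \<and> P \<subseteq> U
        \<and> kappa_cut V E W \<and> W \<inter> B \<noteq> {}
        \<and> matching_cut V E U A P ((U - P) \<union> (W \<inter> A)))"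

end

theory Submission
  imports Defs
begin

text \<open>
  A \<open>\<kappa>\<close>-cut \<open>X\<close> that is not \<open>(I, \<kappa> - 1)\<close>-small splits the other vertices into two unconnected parts
  \<open>K\<close> and \<open>L\<close> with at least \<open>\<kappa>\<close> vertices each. All inequalities of the proof are corner inequalities:
  if \<open>(A, U, B)\<close> is another separation with \<open>|U| = \<kappa>\<close> and \<open>A\<close> meets \<open>K\<close>, then
  \<open>|X \<inter> B| \<le> |K \<inter> U|\<close>.
  If every sector outside \<open>X\<close> meets both \<open>K\<close> and \<open>L\<close>, the corner inequalities leave at most one such
  sector and the wheel is small. Otherwise, up to exchanging \<open>K\<close> and \<open>L\<close>, some sector meets \<open>K\<close> but not \<open>L\<close>.
  Unless \<open>X\<close> is laminar or crossing matching, this sector lies inside \<open>K\<close> and its bounding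
  cut avoids \<open>L\<close>. Going around the wheel from there, consider the first and the last of the sets \<open>C\<^sub>k\<close>, \<open>S\<^sub>k\<close>
  that meet \<open>L\<close>: if one of them is a \<open>C\<^sub>k\<close>, or if they coincide, then \<open>X\<close> is again laminar or crossing
  matching; if they are distinct sectors, then \<open>X\<close> consists of \<open>T\<close> and two sets of size \<open>|C\<^sub>k|\<close>, each of which
  is some \<open>C\<^sub>k\<close> or splits one of these two sectors and can be inserted into the wheel.
\<close>

section \<open>Vertex separations\<close>

text \<open>Either part may be a union of several components, so one cut \<open>S\<close> carries
  many such triples; edges stand in for paths.\<close>

definition vsep :: "'a set \<Rightarrow> ('a \<Rightarrow> 'a \<Rightarrow> bool) \<Rightarrow> 'a set \<Rightarrow> 'a set \<Rightarrow> 'a set \<Rightarrow> bool" where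
  "vsep V E A S B \<longleftrightarrow> A \<noteq> {} \<and> B \<noteq> {} \<and> A \<union> S \<union> B = V \<and> A \<inter> S = {} \<and> A \<inter> B = {} \<and> S \<inter> B = {}
     \<and> (\<forall>x\<in>A. \<forall>y\<in>B. \<not> E x y)"

lemma vsepI:
  assumes "A \<noteq> {}" "B \<noteq> {}" "A \<union> S \<union> B \<subseteq> V" "\<And>x. x \<in> V \<Longrightarrow> x \<in> A \<or> x \<in> S \<or> x \<in> B"
    "A \<inter> S = {}" "A \<inter> B = {}" "S \<inter> B = {}" "\<And>x y. x \<in> A \<Longrightarrow> y \<in> B \<Longrightarrow> \<not> E x y"
  shows "vsep V E A S B"
  using assms unfolding vsep_def by auto

lemma reach_closed:
  assumes "reach E Z x y" "x \<in> A" "\<And>u v. u \<in> A \<Longrightarrow> v \<in> Z \<Longrightarrow> E u v \<Longrightarrow> v \<in> A"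
  shows "y \<in> A"
proof -
  have "(x, y) \<in> {(a, b). a \<in> Z \<and> b \<in> Z \<and> E a b}\<^sup>*"
    using assms(1) by (simp add: reach_def)
  then show ?thesis
    by (induction rule: rtrancl_induct) (use assms(2,3) in auto)
qed

lemma reach_refl: "x \<in> Z \<Longrightarrow> reach E Z x x"
  by (simp add: reach_def)

lemma reach_step:
  assumes "reach E Z x y" "z \<in> Z" "E y z"
  shows "reach E Z x z"
  using assms unfolding reach_def by (auto intro: rtrancl_into_rtrancl)

lemma reach_trans: "reach E Z x y \<Longrightarrow> reach E Z y z \<Longrightarrow> reach E Z x z"
  unfolding reach_def by auto

lemma reach_sym:
  assumes "\<And>u v. E u v \<Longrightarrow> E v u" "reach E Z x y"
  shows "reach E Z y x"
proof -
  have "(x, y) \<in> {(a, b). a \<in> Z \<and> b \<in> Z \<and> E a b}\<^sup>*"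
    using assms(2) by (simp add: reach_def)
  then have "(y, x) \<in> {(a, b). a \<in> Z \<and> b \<in> Z \<and> E a b}\<^sup>*"
    by (induction rule: rtrancl_induct)
      (auto intro: converse_rtrancl_into_rtrancl assms(1))
  then show ?thesis using assms(2) by (simp add: reach_def)
qed

lemma vsep_not_reach:
  assumes "vsep V E A S B" "x \<in> A" "y \<in> B"
  shows "\<not> reach E (V - S) x y"
proof
  assume "reach E (V - S) x y"
  then have "y \<in> A"
    by (rule reach_closed) (use assms in \<open>auto simp: vsep_def\<close>)
  with assms show False by (auto simp: vsep_def)
qed

lemma vsep_is_cut: "vsep V E A S B \<Longrightarrow> is_cut V E S"
  unfolding is_cut_def using vsep_not_reach[of V E A S B]
  by (auto simp: vsep_def) blast

locale sgraph =
  fixes V :: "'a set" and E :: "'a \<Rightarrow> 'a \<Rightarrow> bool"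
  assumes fin: "finite V"
    and edge_in: "E x y \<Longrightarrow> x \<in> V \<and> y \<in> V"
    and edge_sym: "E x y \<Longrightarrow> E y x"
begin

abbreviation "sep \<equiv> vsep V E"
abbreviation "\<kappa> \<equiv> kappa V E"

lemma sep_sym: "sep A S B \<Longrightarrow> sep B S A"
  unfolding vsep_def using edge_sym by blast

lemma sepD:
  assumes "sep A S B"
  shows "finite A" "finite S" "finite B" "A \<subseteq> V" "S \<subseteq> V" "B \<subseteq> V"
  using assms fin unfolding vsep_def by (auto intro: finite_subset)

lemma sep_disj:
  assumes "sep A S B"
  shows "A \<inter> S = {}" "A \<inter> B = {}" "S \<inter> B = {}" "B \<inter> S = {}" "B \<inter> A = {}" "S \<inter> A = {}"
  using assms unfolding vsep_def by blast+

lemma sep_no_edge: "sep A S B \<Longrightarrow> x \<in> A \<Longrightarrow> y \<in> B \<Longrightarrow> \<not> E x y"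
  by (simp add: vsep_def)

lemma sep_mem:
  assumes "sep A S B" "x \<in> V"
  shows "x \<in> A \<and> x \<notin> S \<and> x \<notin> B \<or> x \<in> S \<and> x \<notin> A \<and> x \<notin> B \<or> x \<in> B \<and> x \<notin> A \<and> x \<notin> S"
  using assms unfolding vsep_def by auto

lemma sep_kappa_le:
  assumes "sep A S B"
  shows "\<kappa> \<le> card S"
proof -
  have "{card U | U. is_cut V E U} \<subseteq> card ` Pow V"
    by (auto simp: is_cut_def)
  then have "finite {card U | U. is_cut V E U}"
    by (rule finite_subset) (use fin in simp)
  moreover have "card S \<in> {card U | U. is_cut V E U}" using vsep_is_cut[OF assms] by blast
  ultimately show ?thesis unfolding kappa_def by (rule Min_le)
qed

lemma sep_kappa_cut: "sep A S B \<Longrightarrow> card S = \<kappa> \<Longrightarrow> kappa_cut V E S"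
  by (simp add: kappa_cut_def vsep_is_cut)

lemma disconnects_sep:
  assumes "disconnects V E S P" "S \<subseteq> V"
  shows "sep P S (V - (S \<union> P))"
proof -
  have "\<not> E x y" if "x \<in> P" "y \<in> V - (S \<union> P)" for x y
  proof
    assume "E x y"
    then have "reach E (V - S) x y"
      using that assms by (intro reach_step[OF reach_refl]) (auto simp: disconnects_def)
    then show False using that assms by (auto simp: disconnects_def)
  qed
  then show ?thesis using assms by (auto simp: disconnects_def vsep_def)
qed

lemma sep_disconnects:
  assumes "sep A S B"
  shows "disconnects V E S A"
proof -
  have "V - (S \<union> A) = B" using assms by (auto simp: vsep_def)
  then show ?thesis
    using assms vsep_not_reach[OF assms] by (auto simp: disconnects_def vsep_def)
qed

lemma sep_card_split:
  assumes "sep A S B" "Z \<subseteq> V"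
  shows "card Z = card (Z \<inter> A) + card (Z \<inter> S) + card (Z \<inter> B)"
proof -
  have "Z = (Z \<inter> A) \<union> (Z \<inter> S) \<union> (Z \<inter> B)" using assms by (auto simp: vsep_def)
  moreover have "finite Z" using assms(2) fin by (rule finite_subset)
  ultimately show ?thesis
    using assms(1) card_Un_disjoint[of "(Z \<inter> A) \<union> (Z \<inter> S)" "Z \<inter> B"]
      card_Un_disjoint[of "Z \<inter> A" "Z \<inter> S"] unfolding vsep_def by fastforce
qed

text \<open>The corner \<open>A \<inter> K\<close> of two crossing separations is separated from the rest by
  \<open>(X \<inter> A) \<union> (X \<inter> U) \<union> (K \<inter> U)\<close>.\<close>
lemma corner:
  assumes AB: "sep A U B" and KL: "sep K X L" and X: "card X = \<kappa>" and ne: "A \<inter> K \<noteq> {}"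
  shows "card (X \<inter> B) \<le> card (K \<inter> U)"
proof -
  let ?W = "(X \<inter> A) \<union> (X \<inter> U) \<union> (K \<inter> U)"
  have "sep (A \<inter> K) ?W (B \<union> L)"
  proof (rule vsepI)
    show "A \<inter> K \<noteq> {}" by (rule ne)
    show "B \<union> L \<noteq> {}" using AB by (auto simp: vsep_def)
    show "x \<in> A \<inter> K \<or> x \<in> ?W \<or> x \<in> B \<union> L" if "x \<in> V" for x
      using sep_mem[OF AB that] sep_mem[OF KL that] by auto
    show "\<not> E x y" if "x \<in> A \<inter> K" "y \<in> B \<union> L" for x y
      using that sep_no_edge[OF AB] sep_no_edge[OF KL] by blast
    show "A \<inter> K \<union> ?W \<union> (B \<union> L) \<subseteq> V" using sepD[OF AB] sepD[OF KL] by auto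
  qed (use sep_disj[OF AB] sep_disj[OF KL] in blast)+
  then have "\<kappa> \<le> card ?W" by (rule sep_kappa_le)
  also have "\<dots> \<le> card (X \<inter> A) + card (X \<inter> U) + card (K \<inter> U)"
    by (meson add_le_mono1 card_Un_le le_trans)
  finally show ?thesis
    using sep_card_split[OF AB, of X] X sepD[OF KL] by simp
qed

section \<open>Connected parts and crossing matching cuts\<close>

text \<open>Used to apply corner inequalities to single components, which is how parts are shown to
  be connected.\<close>

lemma component_sep:
  assumes "sep A U B" "x \<in> A"
  defines "D \<equiv> {y. reach E (V - U) x y}"
  shows "x \<in> D" "D \<subseteq> A" "sep D U ((A - D) \<union> B)"
proof -
  have xVU: "x \<in> V - U" using assms by (auto simp: vsep_def)
  show xD: "x \<in> D" using xVU by (simp add: D_def reach_refl)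
  show DA: "D \<subseteq> A"
  proof
    fix y assume "y \<in> D"
    then have r: "reach E (V - U) x y" by (simp add: D_def)
    show "y \<in> A" 
    proof (rule ccontr)
      assume "y \<notin> A"
      then have "y \<in> B" using r assms(1) by (auto simp: reach_def vsep_def)
      then show False using vsep_not_reach[OF assms(1,2)] r by blast
    qed
  qed
  have "\<not> E u v" if "u \<in> D" "v \<in> (A - D) \<union> B" for u v
  proof
    assume "E u v"
    moreover have "v \<in> V - U" using that assms(1) by (auto simp: vsep_def)
    ultimately have "v \<in> D" using that(1) unfolding D_def by (auto intro: reach_step)
    then show False using that(2) DA assms(1) by (auto simp: vsep_def)
  qed
  then show "sep D U ((A - D) \<union> B)"
    using assms(1) xD DA by (auto simp: vsep_def)
qed

lemma component_eq:
  assumes "reach E Z x z" "reach E Z y z"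
  shows "{u. reach E Z x u} = {u. reach E Z y u}"
proof -
  have "reach E Z x y" "reach E Z y x"
    using assms reach_sym[of E Z] reach_trans[of E Z] edge_sym by blast+
  then show ?thesis using reach_trans[of E Z] by blast
qed

text \<open>The opposite corners \<open>A \<inter> K\<close> and \<open>B \<inter> L\<close> give
  \<open>card (X \<inter> A) = card (U \<inter> L)\<close>, so trading \<open>U \<inter> L\<close>
  for \<open>X \<inter> A\<close> keeps the size of \<open>U\<close> and cuts off
  \<open>A \<inter> K\<close>. The same equality forces \<open>A\<close> and \<open>B\<close> to be
  connected.\<close>

theorem crossing_from_pure_side:
  assumes AB: "sep A U B" and U: "card U = \<kappa>" and KL: "sep K X L" and X: "card X = \<kappa>"
    and AL: "A \<inter> L = {}" and AK: "A \<inter> K \<noteq> {}" and UL: "L \<inter> U \<noteq> {}"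
    and XB: "X \<inter> B \<noteq> {}" and LB: "B \<inter> L \<noteq> {}"
  shows "sides V E U = {A, B}" "crossing_matching_cut V E U A (L \<inter> U) X"
proof -
  define D where "D x = {y. reach E (V - U) x y}" for x
  note f = sepD[OF AB] sepD[OF KL]
  \<comment> \<open>The corner inequality with the two separations in exchanged roles, for arbitrary
    \<open>A'\<close> so that it also covers components of \<open>A\<close> and
    \<open>B\<close>.\<close>
  have cK: "card (U \<inter> L) \<le> card (X \<inter> A')" if "sep A' U B'" "A' \<inter> K \<noteq> {}" for A' B'
    using corner[OF sep_sym[OF KL] sep_sym[OF that(1)] U] that(2) corner[OF KL that(1) U]
    by (simp add: Int_commute)
  have eqc: "card (X \<inter> A) = card (U \<inter> L)"
    using cK[OF AB AK] corner[OF sep_sym[OF AB] sep_sym[OF KL] X LB] by (simp add: Int_commute)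
  have pos: "card (U \<inter> L) > 0" using UL f by (simp add: card_gt_0_iff Int_commute)
  have DD: "D x = D y" if "z \<in> D x" "z \<in> D y" for x y z
    using that component_eq unfolding D_def by blast
  \<comment> \<open>By \<open>cK\<close> a component meeting \<open>K\<close> already has as many
    vertices of \<open>X\<close> as all of \<open>A\<close>.\<close>
  have XA: "X \<inter> A \<subseteq> D x" if "x \<in> A" "D x \<inter> K \<noteq> {}" for x
  proof -
    note c = component_sep[OF AB that(1), folded D_def]
    have "card (X \<inter> A) \<le> card (X \<inter> D x)" using cK[OF c(3) that(2)] eqc by simp
    then have "X \<inter> D x = X \<inter> A" using c(2) f by (intro card_seteq) auto
    then show ?thesis by blast
  qed
  have compA: "D x = A" if x: "x \<in> A" for x
  proof -
    obtain y where y: "y \<in> A" "y \<in> K" using AK by blast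
    note cy = component_sep[OF AB y(1), folded D_def]
    have Xy: "X \<inter> A \<subseteq> D y" using XA[OF y(1)] cy(1) y by blast
    \<comment> \<open>A component meeting \<open>K\<close> shares the nonempty
      \<open>X \<inter> A\<close> with \<open>D y\<close>; one missing \<open>K\<close> consists of
      vertices of \<open>X\<close>, because \<open>A\<close> misses \<open>L\<close>.\<close>
    have all: "z \<in> D y" if z: "z \<in> A" for z
    proof (cases "D z \<inter> K = {}")
      case True
      note cz = component_sep[OF AB z, folded D_def]
      have "z \<in> V" using z f by blast
      then have "z \<in> X" using True cz(1) AL z sep_mem[OF KL] by blast
      then show ?thesis using Xy z by blast
    next
      case False
      obtain u where "u \<in> X \<inter> A" using pos eqc by (metis card_gt_0_iff ex_in_conv)
      then have "D z = D y" using XA[OF z False] Xy DD by blast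
      then show ?thesis using component_sep(1)[OF AB z, folded D_def] by simp
    qed
    then have "D x = D y" using DD component_sep(1)[OF AB x, folded D_def] x by blast
    then show ?thesis using all cy by blast
  qed
  note BA = sep_sym[OF AB]
  \<comment> \<open>The rest of \<open>B\<close> is moved to the side of \<open>A\<close>: the
    corner at \<open>D x \<inter> L\<close> then shows that \<open>X\<close> misses
    \<open>B - D x\<close>.\<close>
  have XB': "X \<inter> B \<subseteq> D x" if "x \<in> B" "D x \<inter> L \<noteq> {}" for x
  proof -
    note c = component_sep[OF BA that(1), folded D_def]
    have "card (X \<inter> ((B - D x) \<union> A)) \<le> card (X \<inter> A)"
      using corner[OF c(3) sep_sym[OF KL] X that(2)] eqc by (simp add: Int_commute)
    then have "X \<inter> A = X \<inter> ((B - D x) \<union> A)" using f by (intro card_seteq) auto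
    then show ?thesis using sep_disj[OF AB] by blast
  qed
  have compB: "D x = B" if x: "x \<in> B" for x
  proof -
    obtain y where y: "y \<in> B" "y \<in> L" using LB by blast
    note cy = component_sep[OF BA y(1), folded D_def]
    have Xy: "X \<inter> B \<subseteq> D y" using XB'[OF y(1)] cy(1) y by blast
    \<comment> \<open>A second component of \<open>B\<close> would miss \<open>X\<close>; it cannot
      meet \<open>L\<close> by \<open>XB'\<close> and \<open>XB\<close>, nor \<open>K\<close> by
      \<open>cK\<close> and \<open>pos\<close>.\<close>
    have all: "z \<in> D y" if z: "z \<in> B" for z
    proof (rule ccontr)
      assume nz: "z \<notin> D y"
      note cz = component_sep[OF BA z, folded D_def]
      have disj: "D z \<inter> D y = {}" using DD nz cz(1) by blast
      then have noX: "X \<inter> D z = {}" using Xy cz(2) by blast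
      have "D z \<inter> L = {}" using XB'[OF z] noX XB by blast
      moreover have "z \<in> V" using z f by blast
      ultimately have "D z \<inter> K \<noteq> {}" using cz(1) noX sep_mem[OF KL] by blast
      then show False using cK[OF cz(3)] noX pos by simp
    qed
    then have "D x = D y" using DD component_sep(1)[OF BA x, folded D_def] x by blast
    then show ?thesis using all cy by blast
  qed
  have VU: "V - U = A \<union> B" using AB by (auto simp: vsep_def)
  have "sides V E U = D ` (A \<union> B)" unfolding sides_def D_def VU by auto
  moreover have "D ` A = {A}" "D ` B = {B}" using compA compB AB by (auto simp: vsep_def)
  ultimately show s: "sides V E U = {A, B}" by (simp add: image_Un insert_commute)
  let ?W = "(U - (L \<inter> U)) \<union> (X \<inter> A)"
  have sW: "sep (A \<inter> K) ?W ((L \<inter> U) \<union> B)"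
  proof (rule vsepI)
    show "A \<inter> K \<noteq> {}" by (rule AK)
    show "(L \<inter> U) \<union> B \<noteq> {}" using AB by (auto simp: vsep_def)
    show "x \<in> A \<inter> K \<or> x \<in> ?W \<or> x \<in> (L \<inter> U) \<union> B" if "x \<in> V" for x
      using sep_mem[OF AB that] sep_mem[OF KL that] AL by auto
    show "\<not> E x y" if "x \<in> A \<inter> K" "y \<in> (L \<inter> U) \<union> B" for x y
      using that sep_no_edge[OF AB] sep_no_edge[OF KL] by blast
    show "A \<inter> K \<union> ?W \<union> (L \<inter> U \<union> B) \<subseteq> V" using f by auto
  qed (use sep_disj[OF AB] sep_disj[OF KL] in blast)+
  have "card ?W = card (U - (L \<inter> U)) + card (X \<inter> A)"
    by (rule card_Un_disjoint) (use f AB in \<open>auto simp: vsep_def\<close>)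
  moreover have "card (U - (L \<inter> U)) = card U - card (L \<inter> U)"
    by (rule card_Diff_subset) (use f in auto)
  moreover have "card (L \<inter> U) \<le> card U" by (rule card_mono) (use f in auto)
  ultimately have "card ?W = \<kappa>" using eqc U by (simp add: Int_commute)
  then have W: "kappa_cut V E ?W" using sep_kappa_cut[OF sW] by blast
  have "A \<subseteq> K \<union> X" using sep_mem[OF KL] AL f(4) by blast
  then have AW: "A - ?W = A \<inter> K" using sep_disj(1)[OF AB] sep_disj(1)[OF KL] by blast
  have rest: "(L \<inter> U) \<union> (V - (U \<union> A)) = (L \<inter> U) \<union> B" using AB by (auto simp: vsep_def)
  have "matching_cut V E U A (L \<inter> U) ?W"
    unfolding matching_cut_def AW rest
  proof (intro conjI ballI)
    show "((L \<inter> U) \<union> B) \<inter> ?W = {}" "A \<inter> K \<inter> ?W = {}" using sep_disj[OF sW] by blast+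
  qed (use W AK vsep_not_reach[OF sep_sym[OF sW]] in auto)
  moreover have "kappa_cut V E X" using sep_kappa_cut[OF KL X] .
  moreover have "A \<noteq> B" using AB by (auto simp: vsep_def)
  ultimately show "crossing_matching_cut V E U A (L \<inter> U) X"
    unfolding crossing_matching_cut_def using s UL XB by (intro exI[of _ B]) auto
qed

section \<open>Balanced separations for cuts that are not small\<close>

lemma sum_other_sides:
  assumes "U \<subseteq> V" "A \<in> sides V E U"
  shows "(\<Sum>B\<in>sides V E U - {A}. card B) = card (V - U - A)"
proof -
  have sub: "B \<subseteq> V - U" if "B \<in> sides V E U" for B
    using that by (auto simp: sides_def reach_def)
  have disj: "B = B'" if "B \<in> sides V E U" "B' \<in> sides V E U" "B \<inter> B' \<noteq> {}" for B B'
    using that component_eq unfolding sides_def by blast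
  have cover: "\<exists>B\<in>sides V E U. x \<in> B" if "x \<in> V - U" for x
    using reach_refl[OF that] that unfolding sides_def by blast
  have finB: "finite B" if "B \<in> sides V E U" for B
    using sub[OF that] fin by (meson finite_Diff finite_subset)
  have fs: "finite (sides V E U)" using fin by (simp add: sides_def)
  have "\<Union>(sides V E U - {A}) = V - U - A"
  proof (rule set_eqI, rule iffI)
    fix x assume "x \<in> \<Union>(sides V E U - {A})"
    then obtain B where "B \<in> sides V E U" "B \<noteq> A" "x \<in> B" by blast
    then show "x \<in> V - U - A" using sub[of B] disj[of B A] assms(2) by blast
  next
    fix x assume x: "x \<in> V - U - A"
    then obtain B where "B \<in> sides V E U" "x \<in> B" using cover by blast
    then show "x \<in> \<Union>(sides V E U - {A})" using x by blast
  qed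
  moreover have "pairwise disjnt (sides V E U - {A})"
    by (rule pairwiseI) (use disj in \<open>auto simp: disjnt_def\<close>)
  ultimately show ?thesis
    using card_Union_disjoint[of "sides V E U - {A}"] finB by simp
qed

text \<open>Among unions of components with at least \<open>\<kappa>\<close> vertices a smallest one
  \<open>K\<close> is taken. If fewer than \<open>\<kappa>\<close> vertices remain, \<open>K\<close>
  has more than \<open>2 * \<kappa>\<close>; a component \<open>D\<close> inside it is proper
  because the cut is not small, and minimality makes both \<open>D\<close> and \<open>K - D\<close>
  smaller than \<open>\<kappa>\<close>.\<close>

lemma not_I_small_balanced:
  assumes U: "is_cut V E U" and cU: "card U = \<kappa>" and big: "4 * \<kappa> < card V"
    and ns: "\<not> I_small V E U (\<kappa> - 1)" and pos: "\<kappa> > 0"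
  obtains K L where "sep K U L" "\<kappa> \<le> card K" "\<kappa> \<le> card L"
proof -
  have UV: "U \<subseteq> V" using U by (simp add: is_cut_def)
  have cVU: "card (V - U) = card V - \<kappa>" using UV cU fin by (simp add: card_Diff_subset finite_subset)
  let ?Q = "\<lambda>K. K \<subseteq> V - U \<and> \<kappa> \<le> card K \<and> (\<forall>x\<in>K. \<forall>y\<in>V - U - K. \<not> E x y)"
  have "?Q (V - U)" using cVU big by auto
  then obtain K where K: "?Q K" and mn: "\<And>K'. ?Q K' \<Longrightarrow> card K \<le> card K'"
    using ex_has_least_nat[of ?Q "V - U" card] by blast
  let ?L = "V - U - K"
  have finK: "finite K" using K fin by (meson finite_Diff finite_subset)
  have tot: "card ?L = card V - \<kappa> - card K" using K finK cVU by (simp add: card_Diff_subset)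
  show thesis
  proof (cases "\<kappa> \<le> card ?L")
    case True
    have "sep K U ?L"
    proof (rule vsepI)
      show "K \<noteq> {}" "?L \<noteq> {}" using True pos K by (metis card.empty not_le)+
    qed (use K UV in auto)
    then show thesis using that K True by blast
  next
    case False
    then have cK: "2 * \<kappa> < card K" using tot big by linarith
    then have "K \<noteq> {}" by force
    then obtain x where x: "x \<in> K" by blast
    define D where "D = {y. reach E (V - U) x y}"
    have DS: "D \<in> sides V E U" using x K by (auto simp: sides_def D_def)
    have xD: "x \<in> D" using x K by (auto simp: D_def intro: reach_refl)
    have DK: "D \<subseteq> K"
    proof
      fix y assume "y \<in> D"
      then have "reach E (V - U) x y" by (simp add: D_def)
      then show "y \<in> K" by (rule reach_closed) (use x K in auto)
    qed
    have finD: "finite D" using DK finK finite_subset by blast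
    have Dcl: "\<not> E u v" if "u \<in> D" "v \<in> V - U - D" for u v
      using that reach_step[of E "V - U" x u v] by (auto simp: D_def)
    have "D \<noteq> K"
    proof
      assume "D = K"
      then have "(\<Sum>B\<in>sides V E U - {D}. card B) = card ?L"
        using sum_other_sides[OF UV DS] by simp
      then show False using ns DS False pos unfolding I_small_def by (metis Suc_pred' less_Suc_eq_le not_le)
    qed
    have c: "card (K - D) = card K - card D" using DK finD by (simp add: card_Diff_subset)
    have "card D > 0" using xD finD card_gt_0_iff by blast
    moreover have "card D < card K" using DK \<open>D \<noteq> K\<close> finK by (simp add: psubset_card_mono psubsetI)
    moreover have "card D < \<kappa>"
    proof (rule ccontr)
      assume "\<not> card D < \<kappa>"
      then have "card K \<le> card D" using DK K Dcl by (intro mn) auto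
      then show False using calculation by simp
    qed
    moreover have "card (K - D) < \<kappa>"
    proof (rule ccontr)
      assume a: "\<not> card (K - D) < \<kappa>"
      have "\<not> E u v" if "u \<in> K - D" "v \<in> V - U - (K - D)" for u v
      proof
        assume e: "E u v"
        have "v \<in> D" using e that K by blast
        then show False using edge_sym[OF e] Dcl[of v u] that K by blast
      qed
      then have "card K \<le> card (K - D)" using a K by (intro mn) auto
      then show False using calculation c by simp
    qed
    ultimately show thesis using c cK by linarith
  qed
qed

end

section \<open>Cyclically indexed wheels\<close>

text \<open>Periodic integer indices avoid case distinctions at the wrap-around. The cuts are
  encoded locally: outside \<open>T\<close>, edges join only neighbouring levels. This form is easy
  to recheck after reversal and insertion.\<close>

locale cyclic_levels = sgraph V E for V :: "'a set" and E :: "'a \<Rightarrow> 'a \<Rightarrow> bool" +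
  fixes T :: "'a set" and C S :: "int \<Rightarrow> 'a set" and w :: int
  assumes w4: "4 \<le> w"
    and C_mod: "C (k mod w) = C k" and S_mod: "S (k mod w) = S k"
    and C_ne: "C k \<noteq> {}" and S_ne: "S k \<noteq> {}"
    and TC: "T \<inter> C k = {}" and TS: "T \<inter> S k = {}" and CS: "C j \<inter> S k = {}"
    and CC_dvd: "\<not> w dvd i - j \<Longrightarrow> C i \<inter> C j = {}"
    and SS_dvd: "\<not> w dvd i - j \<Longrightarrow> S i \<inter> S j = {}"
    and cover: "V = T \<union> (\<Union>k. C k) \<union> (\<Union>k. S k)"
    and S_nb: "x \<in> S k \<Longrightarrow> E x y \<Longrightarrow> y \<in> S k \<union> C k \<union> C (k + 1) \<union> T"
    and C_nb: "x \<in> C k \<Longrightarrow> E x y \<Longrightarrow> y \<in> C (k - 1) \<union> S (k - 1) \<union> C k \<union> S k \<union> C (k + 1) \<union> T"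
begin

text \<open>The levels strictly between \<open>C i\<close> and \<open>C j\<close>, going
  upwards.\<close>

definition arc :: "int \<Rightarrow> int \<Rightarrow> 'a set" where
  "arc i j = (\<Union>k\<in>{i..<j}. S k) \<union> (\<Union>k\<in>{i<..<j}. C k)"

definition hub :: "int \<Rightarrow> int \<Rightarrow> 'a set" where
  "hub i j = C i \<union> T \<union> C j"

lemma C_per: "C (k + w) = C k" and S_per: "S (k + w) = S k"
  using C_mod[of "k + w"] C_mod[of k] S_mod[of "k + w"] S_mod[of k] by simp_all

lemma C_window: "\<exists>k'\<in>{i..<i + w}. C k' = C k" and S_window: "\<exists>k'\<in>{i..<i + w}. S k' = S k"
proof -
  let ?k = "i + (k - i) mod w"
  have k: "?k \<in> {i..<i + w}" using w4 by simp
  have "?k mod w = k mod w" by (simp add: mod_simps)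
  then have "C ?k = C k" "S ?k = S k" using C_mod[of ?k] C_mod[of k] S_mod[of ?k] S_mod[of k] by simp_all
  then show "\<exists>k'\<in>{i..<i + w}. C k' = C k" "\<exists>k'\<in>{i..<i + w}. S k' = S k" using k by blast+
qed

lemma window_dvd: "i < j \<Longrightarrow> j < i + w \<Longrightarrow> \<not> w dvd i - j"
  using zdvd_not_zless[of "j - i" w] by (simp add: dvd_diff_commute)

lemma CC: "i < j \<Longrightarrow> j < i + w \<Longrightarrow> C i \<inter> C j = {}"
  and SS: "i < j \<Longrightarrow> j < i + w \<Longrightarrow> S i \<inter> S j = {}"
  using CC_dvd SS_dvd window_dvd by blast+

lemma S_arc: "i \<le> k \<Longrightarrow> k < j \<Longrightarrow> S k \<subseteq> arc i j"
  and C_arc: "i < k \<Longrightarrow> k < j \<Longrightarrow> C k \<subseteq> arc i j"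
  by (auto simp: arc_def)

lemma arc_mono: "i \<le> i' \<Longrightarrow> j' \<le> j \<Longrightarrow> arc i' j' \<subseteq> arc i j"
  unfolding arc_def by (intro Un_mono UN_mono) auto

lemma arc_1: "arc k (k + 1) = S k"
proof -
  have "{k..<k + 1} = {k}" "{k<..<k + 1} = {}" by auto
  then show ?thesis by (simp add: arc_def)
qed

lemma arc_2: "arc k (k + 2) = S k \<union> C (k + 1) \<union> S (k + 1)"
proof -
  have "{k..<k + 2} = {k, k + 1}" "{k<..<k + 2} = {k + 1}" by auto
  then show ?thesis by (auto simp: arc_def)
qed

lemma subs: "T \<subseteq> V" "C k \<subseteq> V" "S k \<subseteq> V" "arc i j \<subseteq> V" "hub i j \<subseteq> V"
  using cover by (auto simp: arc_def hub_def)

lemma fins: "finite T" "finite (C k)" "finite (S k)" "finite (arc i j)" "finite (hub i j)"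
  by (rule subs[THEN finite_subset, OF fin])+

lemma hub_arc_disj: "j \<le> i + w \<Longrightarrow> hub i j \<inter> arc i j = {}"
proof -
  assume j: "j \<le> i + w"
  have "C i \<inter> C k = {}" "C j \<inter> C k = {}" if "i < k" "k < j" for k
    using that j CC[of i k] CC[of k j] by auto
  then have "x \<notin> hub i j" if "x \<in> arc i j" for x
    using that TC TS CS unfolding hub_def arc_def Un_iff UN_iff by (elim disjE bexE) fastforce+
  then show ?thesis by blast
qed

lemma arcs_disj:
  assumes "j \<le> i + w" shows "arc i j \<inter> arc j (i + w) = {}"
proof -
  have 1: "C k \<inter> C l = {}" if "i < k" "k < j" "j < l" "l < i + w" for k l
    using that CC[of k l] by auto
  have 2: "S k \<inter> S l = {}" if "i \<le> k" "k < j" "j \<le> l" "l < i + w" for k l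
    using that SS[of k l] by auto
  have 3: "S l \<inter> C k = {}" for k l using CS by blast
  show ?thesis
  proof (rule ccontr)
    assume "arc i j \<inter> arc j (i + w) \<noteq> {}"
    then obtain x where x: "x \<in> arc i j" "x \<in> arc j (i + w)" by blast
    show False
      using x 1 2 3 unfolding arc_def Un_iff UN_iff by (elim disjE bexE) fastforce+
  qed
qed

text \<open>Edges reach only adjacent levels or \<open>T\<close>, so an arc can be left only through
  its two end sets or \<open>T\<close>. This gives a cut for every pair of distinct hub sets, in
  particular around a single sector.\<close>

lemma arc_sep:
  assumes "i < j" "j < i + w"
  shows "sep (arc i j) (hub i j) (arc j (i + w))"
proof (rule vsepI)
  have hub2: "hub j (i + w) = hub i j" by (auto simp: hub_def C_per)
  show "arc i j \<noteq> {}" using S_arc[of i i j] S_ne[of i] assms by auto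
  show "arc j (i + w) \<noteq> {}" using S_arc[of j j "i + w"] S_ne[of j] assms by auto
  show "arc i j \<union> hub i j \<union> arc j (i + w) \<subseteq> V" using subs by blast
  show 1: "arc i j \<inter> hub i j = {}" using hub_arc_disj[of j i] assms by auto
  show 2: "arc i j \<inter> arc j (i + w) = {}" using arcs_disj assms by auto
  show 3: "hub i j \<inter> arc j (i + w) = {}" using hub_arc_disj[of "i + w" j] assms hub2 by auto
  have Sc: "S k \<subseteq> arc i j \<union> arc j (i + w)" for k
  proof -
    obtain k' where "k' \<in> {i..<i + w}" "S k' = S k" using S_window by blast
    then show ?thesis using S_arc[of i k' j] S_arc[of j k' "i + w"] by fastforce
  qed
  have Cc: "C k \<subseteq> arc i j \<union> hub i j \<union> arc j (i + w)" for k
  proof -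
    obtain k' where k': "k' \<in> {i..<i + w}" "C k' = C k" using C_window by blast
    then consider "k' = i" | "k' = j" | "i < k'" "k' < j" | "j < k'" "k' < i + w" by fastforce
    then show ?thesis
    proof cases
      case 3 then show ?thesis using C_arc[of i k' j] k' by blast
    next
      case 4 then show ?thesis using C_arc[of j k' "i + w"] k' by blast
    qed (use k' in \<open>auto simp: hub_def\<close>)
  qed
  show "x \<in> arc i j \<or> x \<in> hub i j \<or> x \<in> arc j (i + w)" if xV: "x \<in> V" for x
  proof -
    consider "x \<in> T" | k where "x \<in> C k" | k where "x \<in> S k" using xV cover by blast
    then show ?thesis
    proof cases
      case 1 then show ?thesis by (simp add: hub_def)
    next
      case 2 then show ?thesis using Cc by blast
    next
      case 3 then show ?thesis using Sc by blast
    qed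
  qed
  show "\<not> E x y" if x: "x \<in> arc i j" and y: "y \<in> arc j (i + w)" for x y
  proof
    assume e: "E x y"
    have Cin: "C k \<subseteq> arc i j \<union> hub i j" if "i \<le> k" "k \<le> j" for k
      using that C_arc[of i k j] by (cases "k = i \<or> k = j") (auto simp: hub_def)
    have "y \<in> arc i j \<union> hub i j"
    proof (cases "\<exists>k\<in>{i..<j}. x \<in> S k")
      case True
      then obtain k where k: "i \<le> k" "k < j" "x \<in> S k" by auto
      then show ?thesis
        using S_nb[OF k(3) e] S_arc[of i k j] Cin[of k] Cin[of "k + 1"] by (auto simp: hub_def)
    next
      case False
      then obtain k where k: "i < k" "k < j" "x \<in> C k" using x by (auto simp: arc_def)
      then show ?thesis
        using C_nb[OF k(3) e] S_arc[of i k j] S_arc[of i "k - 1" j] Cin[of k] Cin[of "k + 1"] Cin[of "k - 1"]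
        by (auto simp: hub_def)
    qed
    then show False using y 2 3 by blast
  qed
qed

lemma card_hub_Int:
  assumes "i < j" "j < i + w"
  shows "card (Z \<inter> hub i j) = card (Z \<inter> C i) + card (Z \<inter> T) + card (Z \<inter> C j)"
proof -
  have eq: "Z \<inter> hub i j = (Z \<inter> C i \<union> Z \<inter> T) \<union> Z \<inter> C j" by (auto simp: hub_def)
  have "card (Z \<inter> hub i j) = card (Z \<inter> C i \<union> Z \<inter> T) + card (Z \<inter> C j)"
    unfolding eq by (rule card_Un_disjoint) (use fins CC[OF assms] TC[of j] in blast)+
  also have "card (Z \<inter> C i \<union> Z \<inter> T) = card (Z \<inter> C i) + card (Z \<inter> T)"
    by (rule card_Un_disjoint) (use fins TC[of i] in blast)+
  finally show ?thesis .
qed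

lemma sector_sep: "sep (S a) (hub a (a + 1)) (arc (a + 1) (a + w))"
  using arc_sep[of a "a + 1"] w4 by (simp add: arc_1)

text \<open>A hub at distance two has exactly \<open>\<kappa>\<close> vertices and one at distance
  one, being a cut around a sector, at least \<open>\<kappa>\<close>. So sizes never increase from
  \<open>C i\<close> to \<open>C (i + 1)\<close>, and around a cycle they are constant.\<close>

lemma card_C_constant:
  assumes hub2: "\<And>i. card (hub i (i + 2)) = \<kappa>"
  shows "card (C k) = card (C 0)" "\<kappa> = 2 * card (C 0) + card T"
proof -
  have h: "card (hub i j) = card (C i) + card T + card (C j)" if "i < j" "j < i + w" for i j
    using card_hub_Int[OF that, of UNIV] by simp
  have h2: "card (C i) + card T + card (C (i + 2)) = \<kappa>" for i
    using h[of i "i + 2"] hub2[of i] w4 by simp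
  have h1: "\<kappa> \<le> card (C i) + card T + card (C (i + 1))" for i
    using sep_kappa_le[OF sector_sep[of i]] h[of i "i + 1"] w4 by simp
  have step: "card (C (i + 1)) \<le> card (C i)" for i
  proof -
    have "i - 1 + 2 = i + 1" by simp
    then show ?thesis using h1[of "i - 1"] h2[of "i - 1"] by (simp add: add.commute)
  qed
  have anti: "card (C (i + int m)) \<le> card (C i)" for i m
  proof (induction m)
    case (Suc m)
    then show ?case using step[of "i + int m"] by (simp add: algebra_simps)
  qed simp
  have eq: "card (C k) = card (C 0)" for k
  proof -
    obtain k' where k': "k' \<in> {0..<0 + w}" "C k' = C k" using C_window by blast
    have "card (C k') \<le> card (C 0)" using anti[of 0 "nat k'"] k' by simp
    moreover have "card (C (k' + int (nat (w - k')))) \<le> card (C k')" by (rule anti)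
    then have "card (C 0) \<le> card (C k')" using k' C_per[of 0] by simp
    ultimately show ?thesis using k' by simp
  qed
  then show "card (C k) = card (C 0)" .
  show "\<kappa> = 2 * card (C 0) + card T" using h2[of 0] eq[of 2] by simp
qed

end

locale cyclic_wheel = cyclic_levels +
  fixes c :: nat
  assumes card_C: "card (C k) = c" and kappa_eq: "kappa V E = 2 * c + card T"
begin

lemma c_pos: "c > 0"
  using card_C[of 0] C_ne[of 0] fins(2)[of 0] card_gt_0_iff[of "C 0"] by simp

lemma card_hub:
  assumes "i < j" "j < i + w"
  shows "card (hub i j) = \<kappa>"
  using card_hub_Int[OF assms, of UNIV] kappa_eq card_C by simp

section \<open>The trichotomy for balanced cuts\<close>

text \<open>The laminar and crossing outcomes, which leave the wheel unchanged; the following lemmas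
  extract structure from their failure.\<close>

definition resolved :: "'a set \<Rightarrow> bool" where
  "resolved X \<longleftrightarrow> (\<exists>k. X \<subseteq> hub k (k + 1) \<union> S k)
     \<or> (\<exists>k U A P. (U = hub k (k + 1) \<or> U = hub k (k + 2)) \<and> crossing_matching_cut V E U A P X)"

definition bal :: "'a set \<Rightarrow> 'a set \<Rightarrow> 'a set \<Rightarrow> bool" where
  "bal K X L \<longleftrightarrow> sep K X L \<and> card X = \<kappa> \<and> \<kappa> \<le> card K \<and> \<kappa> \<le> card L"

lemma bal_sym: "bal K X L \<Longrightarrow> bal L X K"
  by (simp add: bal_def sep_sym)

lemma balD:
  assumes "bal K X L"
  shows "sep K X L" "sep L X K" "card X = \<kappa>" "\<kappa> \<le> card K" "\<kappa> \<le> card L" "K \<subseteq> V" "X \<subseteq> V" "L \<subseteq> V"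
    "finite K" "finite X" "finite L"
  using assms sepD[of K X L] sep_sym[of K X L] by (auto simp: bal_def)

lemma bal_part: "bal K X L \<Longrightarrow> Z \<subseteq> V \<Longrightarrow> Z \<subseteq> K \<union> X \<union> L"
  using sep_mem[OF balD(1)] by blast

lemma bal_card:
  assumes "bal K X L" "Z \<subseteq> V"
  shows "card Z = card (K \<inter> Z) + card (X \<inter> Z) + card (L \<inter> Z)"
  using sep_card_split[OF balD(1)[OF assms(1)] assms(2)] by (simp add: Int_commute)

lemma cornerX:
  assumes "bal K X L" "sep A U B" "A \<inter> K \<noteq> {}"
  shows "card (X \<inter> B) \<le> card (K \<inter> U)"
  using corner[OF assms(2) balD(1,3)[OF assms(1)] assms(3)] .

lemma cornerU:
  assumes "bal K X L" "sep A U B" "card U = \<kappa>" "A \<inter> K \<noteq> {}"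
  shows "card (L \<inter> U) \<le> card (X \<inter> A)"
  using corner[OF balD(1)[OF assms(1)] assms(2,3)] assms(4) by (simp add: Int_commute)

lemma crossing_resolved:
  assumes b: "bal K X L" and ij: "j = i + 1 \<or> j = i + 2"
    and "arc i j \<inter> L = {}" "arc i j \<inter> K \<noteq> {}" "L \<inter> hub i j \<noteq> {}"
    "X \<inter> arc j (i + w) \<noteq> {}" "arc j (i + w) \<inter> L \<noteq> {}"
  shows "resolved X"
proof -
  have "i < j" "j < i + w" using ij w4 by auto
  from crossing_from_pure_side(2)[OF arc_sep[OF this] card_hub[OF this] balD(1,3)[OF b] assms(3-7)]
  show ?thesis unfolding resolved_def using ij by blast
qed

section \<open>Pure and mixed sectors\<close>

text \<open>\<open>X\<close> reaches beyond the hub because it is not laminar, and so does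
  \<open>L\<close>: otherwise \<open>L\<close> would fill the hub and force \<open>X\<close> into
  the sector. If \<open>L\<close> met the hub, \<open>X\<close> would be crossing; so it does not,
  and the opposite corner leaves no room for \<open>X\<close> in the sector.\<close>

lemma pure_sector:
  assumes b: "bal K X L" and nr: "\<not> resolved X" and SK: "S a \<inter> K \<noteq> {}" and SL: "S a \<inter> L = {}"
  shows "X \<inter> S a = {}" "L \<inter> hub a (a + 1) = {}"
proof -
  let ?U = "hub a (a + 1)" and ?B = "arc (a + 1) (a + w)"
  note AB = sector_sep[of a]
  note d = balD[OF b]
  have cU: "card ?U = \<kappa>" using card_hub[of a "a + 1"] w4 by simp
  have nlam: "\<not> X \<subseteq> ?U \<union> S a" using nr by (auto simp: resolved_def)
  then have XB: "X \<inter> ?B \<noteq> {}" using sep_mem[OF AB] d(7) by blast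
  have LB: "?B \<inter> L \<noteq> {}"
  proof
    assume "?B \<inter> L = {}"
    then have "L \<subseteq> ?U" using sep_mem[OF AB] d(8) SL by blast
    then have "L = ?U" using card_seteq[of ?U L] fins d(5) cU by simp
    then have "card X \<le> card (X \<inter> S a)" using cornerU[OF b AB cU SK] cU d(3) by simp
    then have "X \<inter> S a = X" using d(10) by (intro card_seteq) auto
    then show False using nlam by blast
  qed
  show UL: "L \<inter> ?U = {}"
  proof (rule ccontr)
    assume "L \<inter> ?U \<noteq> {}"
    then have "resolved X" using crossing_resolved[OF b, of "a + 1" a] SK SL XB LB by (simp add: arc_1)
    then show False using nr by simp
  qed
  have "card (X \<inter> S a) \<le> card (L \<inter> ?U)"
    using cornerX[OF bal_sym[OF b] sep_sym[OF AB] LB] .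
  then show "X \<inter> S a = {}" using UL d(10) by simp
qed

text \<open>All four corners are nonempty, so \<open>K\<close> and \<open>L\<close> each have on the
  hub at least the larger of the two amounts of \<open>X\<close> inside and beyond. Since hub and
  \<open>X\<close> both have size \<open>\<kappa>\<close>, the amounts agree.\<close>

lemma mixed_sector_balance:
  assumes b: "bal K X L" and "S a \<inter> K \<noteq> {}" "S a \<inter> L \<noteq> {}"
    "arc (a + 1) (a + w) \<inter> K \<noteq> {}" "arc (a + 1) (a + w) \<inter> L \<noteq> {}"
  shows "card (X \<inter> S a) = card (X \<inter> arc (a + 1) (a + w))"
proof -
  let ?U = "hub a (a + 1)" and ?B = "arc (a + 1) (a + w)"
  note AB = sector_sep[of a]
  have cU: "card ?U = \<kappa>" using card_hub[of a "a + 1"] w4 by simp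
  have "card (X \<inter> ?B) \<le> card (K \<inter> ?U)" "card (X \<inter> ?B) \<le> card (L \<inter> ?U)"
    "card (X \<inter> S a) \<le> card (K \<inter> ?U)" "card (X \<inter> S a) \<le> card (L \<inter> ?U)"
    using cornerX[OF b AB] cornerX[OF bal_sym[OF b] AB] cornerX[OF b sep_sym[OF AB]]
      cornerX[OF bal_sym[OF b] sep_sym[OF AB]] assms(2-5) by simp_all
  moreover have "\<kappa> = card (K \<inter> ?U) + card (X \<inter> ?U) + card (L \<inter> ?U)"
    using bal_card[OF b subs(5)] cU by simp
  moreover have "\<kappa> = card (X \<inter> S a) + card (X \<inter> ?U) + card (X \<inter> ?B)"
    using sep_card_split[OF AB balD(7)[OF b]] balD(3)[OF b] by simp
  ultimately show ?thesis by linarith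
qed

text \<open>A sector missing \<open>K\<close> lies in \<open>X\<close>. Two sectors meeting
  \<open>K\<close> would, by the balance and with the help of a third, make \<open>X\<close> the hub
  of one sector and a subset of the hub of another with different ends.\<close>

lemma no_pure_sector:
  assumes b: "bal K X L" and np: "\<And>a. S a \<inter> K \<noteq> {} \<longleftrightarrow> S a \<inter> L \<noteq> {}"
  shows "\<exists>m. \<forall>a\<in>{m<..<m + w}. S a \<subseteq> X"
proof -
  have inX: "S a \<subseteq> X" if "S a \<inter> K = {}" for a
    using that np[of a] bal_part[OF b subs(3)[of a]] by blast
  note d = balD[OF b]
  have unique: False if ab: "a < b'" "b' < a + w" "S a \<inter> K \<noteq> {}" "S b' \<inter> K \<noteq> {}" for a b'
  proof -
    have balance: "card (X \<inter> S i) = card (X \<inter> arc (i + 1) (i + w))"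
      if "i < j" "j < i + w" "S i \<inter> K \<noteq> {}" "S j \<inter> K \<noteq> {}" for i j
    proof -
      have "S j \<subseteq> arc (i + 1) (i + w)" using S_arc[of "i + 1" j "i + w"] that by simp
      then show ?thesis
        using mixed_sector_balance[OF b, of i] that(3,4) np[of i] np[of j] by blast
    qed
    have ea: "card (X \<inter> S a) = card (X \<inter> arc (a + 1) (a + w))" using balance[OF ab] .
    have eb: "card (X \<inter> S b') = card (X \<inter> arc (b' + 1) (b' + w))"
      using balance[of b' "a + w"] ab S_per by simp
    have Sb: "S b' \<subseteq> arc (a + 1) (a + w)" using S_arc[of "a + 1" b' "a + w"] ab by simp
    have Sa: "S a \<subseteq> arc (b' + 1) (b' + w)" using S_arc[of "b' + 1" "a + w" "b' + w"] ab S_per by simp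
    \<comment> \<open>Each sector lies beyond the hub of the other, so the two balances make
      \<open>X \<inter> S b'\<close> all of \<open>X\<close> beyond the hub of
      \<open>S a\<close>.\<close>
    have "card (X \<inter> S a) \<le> card (X \<inter> S b')" unfolding eb by (rule card_mono) (use Sa fins in auto)
    then have eqb: "X \<inter> S b' = X \<inter> arc (a + 1) (a + w)"
      using ea Sb fins by (intro card_seteq) auto
    \<comment> \<open>A third sector, available by \<open>w4\<close>; it misses \<open>X\<close>
      because it is disjoint from \<open>S b'\<close>.\<close>
    obtain m where m: "a < m" "m < a + w" "m \<noteq> b'"
    proof (cases "b' = a + 1")
      case True then show ?thesis using that[of "a + 2"] w4 by simp
    next
      case False then show ?thesis using that[of "a + 1"] w4 by simp
    qed
    have Sm: "S m \<subseteq> arc (a + 1) (a + w)" using S_arc[of "a + 1" m "a + w"] m by simp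
    have "S m \<inter> S b' = {}" using SS[of m b'] SS[of b' m] m ab by (cases "m < b'") auto
    then have Xm: "X \<inter> S m = {}" using Sm eqb by blast
    then have mK: "S m \<inter> K \<noteq> {}" using inX[of m] S_ne[of m] by blast
    have em: "card (X \<inter> S m) = card (X \<inter> arc (m + 1) (m + w))"
      using balance[of m "a + w"] m mK ab(3) S_per by simp
    then have Xmo: "X \<inter> arc (m + 1) (m + w) = {}" using Xm fins by simp
    have "S a \<subseteq> arc (m + 1) (m + w)" using S_arc[of "m + 1" "a + w" "m + w"] m S_per by simp
    then have Xa: "X \<inter> S a = {}" using Xmo by blast
    then have Xao: "X \<inter> arc (a + 1) (a + w) = {}" using ea fins by simp
    have "X \<subseteq> hub a (a + 1)" using Xa Xao sep_mem[OF sector_sep[of a]] d(7) by blast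
    moreover have "card (hub a (a + 1)) = card X" using card_hub[of a "a + 1"] w4 d(3) by simp
    ultimately have X: "X = hub a (a + 1)" using card_seteq[of "hub a (a + 1)" X] fins by simp
    have "X \<subseteq> hub m (m + 1)" using Xm Xmo sep_mem[OF sector_sep[of m]] d(7) by blast
    then have CCm: "C a \<subseteq> hub m (m + 1)" "C (a + 1) \<subseteq> hub m (m + 1)" using X by (auto simp: hub_def)
    \<comment> \<open>\<open>C a\<close> lies in the hub of \<open>S m\<close> only if
      \<open>S m\<close> directly precedes \<open>S a\<close>, and then \<open>C (a + 1)\<close> is
      not in it.\<close>
    have "m + 1 = a + w"
    proof (rule ccontr)
      assume "m + 1 \<noteq> a + w"
      then have "C a \<inter> hub m (m + 1) = {}" using CC[of a m] CC[of a "m + 1"] TC[of a] m by (auto simp: hub_def)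
      then show False using CCm C_ne[of a] by blast
    qed
    then have "C (a + 1) \<inter> hub m (m + 1) = {}"
      using CC[of "a + 1" m] CC[of "a + 1" "m + 1"] TC[of "a + 1"] m w4 by (auto simp: hub_def)
    then show False using CCm C_ne[of "a + 1"] by blast
  qed
  show ?thesis
  proof (cases "\<exists>m. S m \<inter> K \<noteq> {}")
    case True
    then obtain m where "S m \<inter> K \<noteq> {}" by blast
    then have "\<forall>a\<in>{m<..<m + w}. S a \<subseteq> X" using unique inX by (meson greaterThanLessThan_iff)
    then show ?thesis by blast
  next
    case False
    then show ?thesis using inX by blast
  qed
qed

section \<open>The two ends of \<open>L\<close> seen from a sector inside \<open>K\<close>\<close>

text \<open>\<open>S i\<close> is the starting point for going around the wheel: all of
  \<open>L\<close> lies in the levels from \<open>S (i + 1)\<close> up to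
  \<open>S (i + w - 1)\<close>.\<close>

definition based :: "'a set \<Rightarrow> 'a set \<Rightarrow> 'a set \<Rightarrow> int \<Rightarrow> bool" where
  "based K X L i \<longleftrightarrow> bal K X L \<and> \<not> resolved X \<and> S i \<subseteq> K \<and> L \<inter> hub i (i + 1) = {}"

lemma pure_sector_based:
  assumes b: "bal K X L" and nr: "\<not> resolved X" and SK: "S a \<inter> K \<noteq> {}" and SL: "S a \<inter> L = {}"
  shows "based K X L a"
  using pure_sector[OF assms] bal_part[OF b subs(3)[of a]] SL b nr unfolding based_def by blast

lemma not_sub_C: "bal K X L \<Longrightarrow> \<not> L \<subseteq> C k"
proof
  assume b: "bal K X L" and "L \<subseteq> C k"
  then have "card L \<le> c" using card_mono[of "C k" L] fins card_C by simp
  then show False using balD(5)[OF b] kappa_eq c_pos by simp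
qed

text \<open>If \<open>L\<close> began with \<open>C f\<close>, the arc of length two ending there
  would make \<open>X\<close> crossing unless \<open>X\<close> has nothing beyond it. Counting then
  forces \<open>f = i + 2\<close>, and the arc from \<open>i + 1\<close> to \<open>i + 3\<close>,
  with \<open>K\<close> and \<open>L\<close> exchanged, makes \<open>X\<close> crossing after
  all.\<close>

lemma first_in_hub_set:
  assumes bs: "based K X L i" and f: "i + 1 < f" "f < i + w"
    and none: "arc i f \<inter> L = {}" and LC: "L \<inter> C f \<noteq> {}"
  shows False
proof -
  have b: "bal K X L" and nr: "\<not> resolved X" and SK: "S i \<subseteq> K" and Li: "L \<inter> hub i (i + 1) = {}"
    using bs by (auto simp: based_def)
  note d = balD[OF b]
  have LT: "L \<inter> T = {}" and LCi: "L \<inter> C i = {}" using Li by (auto simp: hub_def)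
  have fw: "i < f" "f - 2 < f" "f < f - 2 + w" using f w4 by auto
  note sA' = arc_sep[OF fw(1) f(2)]
  have LU': "L \<inter> hub i f = L \<inter> C f" using LT LCi by (auto simp: hub_def)
  have "S i \<subseteq> arc i f" using S_arc[of i i f] fw by simp
  then have KA': "arc i f \<inter> K \<noteq> {}" using SK S_ne[of i] by blast
  have LB': "arc f (i + w) \<inter> L \<noteq> {}"
  proof
    assume "arc f (i + w) \<inter> L = {}"
    then have "L \<subseteq> hub i f" using sep_mem[OF sA'] d(8) none by blast
    then show False using LU' not_sub_C[OF b, of f] by blast
  qed
  \<comment> \<open>The corners \<open>arc i f \<inter> K\<close> and
    \<open>arc f (i + w) \<inter> L\<close> give the two inequalities.\<close>
  have xA': "card (X \<inter> arc i f) = card (L \<inter> C f)"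
    using cornerU[OF b sA' card_hub[OF fw(1) f(2)] KA'] cornerX[OF bal_sym[OF b] sep_sym[OF sA'] LB'] LU' by simp
  have cf: "c = card (K \<inter> C f) + card (X \<inter> C f) + card (L \<inter> C f)"
    using bal_card[OF b subs(2)] card_C by simp
  have S1A': "S (f - 1) \<subseteq> arc i f" and C1A': "C (f - 1) \<subseteq> arc i f"
    using S_arc[of i "f - 1" f] C_arc[of i "f - 1" f] f by auto
  \<comment> \<open>Otherwise \<open>S (f - 1)\<close> would be pure, and its hub, which contains
    \<open>C f\<close>, would avoid \<open>L\<close>.\<close>
  have S1K: "S (f - 1) \<inter> K = {}"
  proof (rule ccontr)
    assume "S (f - 1) \<inter> K \<noteq> {}"
    then have "L \<inter> hub (f - 1) (f - 1 + 1) = {}" using pure_sector(2)[OF b nr] S1A' none by blast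
    then show False using LC by (auto simp: hub_def)
  qed
  then have S1X: "S (f - 1) \<subseteq> X" using S1A' none bal_part[OF b subs(3)[of "f - 1"]] by blast
  \<comment> \<open>Otherwise \<open>C (f - 1)\<close>, of size \<open>c\<close>, and the nonempty
    \<open>S (f - 1)\<close> would both lie in \<open>X \<inter> arc i f\<close>, which has at most
    \<open>c\<close> vertices by \<open>xA'\<close>.\<close>
  have C1K: "C (f - 1) \<inter> K \<noteq> {}"
  proof
    assume "C (f - 1) \<inter> K = {}"
    then have "C (f - 1) \<subseteq> X" using C1A' none bal_part[OF b subs(2)[of "f - 1"]] by blast
    then have "S (f - 1) \<union> C (f - 1) \<subseteq> X \<inter> arc i f" using S1X S1A' C1A' by blast
    then have "card (S (f - 1) \<union> C (f - 1)) \<le> card (L \<inter> C f)" unfolding xA'[symmetric]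
      by (rule card_mono[rotated]) (use fins in auto)
    moreover have "card (S (f - 1) \<union> C (f - 1)) = card (S (f - 1)) + card (C (f - 1))"
      by (rule card_Un_disjoint) (use fins CS[of "f - 1" "f - 1"] in auto)
    moreover have "card (S (f - 1)) > 0" using S_ne[of "f - 1"] fins(3)[of "f - 1"] by (simp add: card_gt_0_iff)
    ultimately show False using cf card_C[of "f - 1"] by simp
  qed
  let ?A = "arc (f - 2) f" and ?U = "hub (f - 2) f" and ?B = "arc f (f - 2 + w)"
  note sA = arc_sep[OF fw(2,3)]
  have AA': "?A \<subseteq> arc i f" using arc_mono[of i "f - 2" f f] f by simp
  have AK: "?A \<inter> K \<noteq> {}" using C1K C_arc[of "f - 2" "f - 1" f] by auto
  have LU: "L \<inter> ?U \<noteq> {}" using LC by (auto simp: hub_def)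
  have LC2: "L \<inter> C (f - 2) = {}"
  proof (cases "f - 2 = i")
    case False
    then show ?thesis using C_arc[of i "f - 2" f] none f by fastforce
  qed (use LCi in simp)
  have LB: "?B \<inter> L \<noteq> {}"
  proof
    assume "?B \<inter> L = {}"
    then have "L \<subseteq> ?U" using sep_mem[OF sA] d(8) none AA' by blast
    then have "L \<subseteq> C f" using LC2 LT by (auto simp: hub_def)
    then show False using not_sub_C[OF b] by blast
  qed
  \<comment> \<open>Every other hypothesis of the crossing criterion holds for this arc, so this one
    must fail.\<close>
  have XB: "X \<inter> ?B = {}"
    using crossing_resolved[OF b, of f "f - 2"] nr none AA' AK LU LB by (auto simp: Int_commute)
  have k1: "\<kappa> = card (X \<inter> ?A) + (card (X \<inter> C (f - 2)) + card (X \<inter> T) + card (X \<inter> C f))"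
    using sep_card_split[OF sA d(7)] d(3) XB card_hub_Int[OF fw(2,3), of X] by simp
  have xT: "card (X \<inter> T) \<le> card T" and x2: "card (X \<inter> C (f - 2)) \<le> c"
    using card_mono[OF fins(1), of "X \<inter> T"] card_mono[OF fins(2), of "X \<inter> C (f - 2)" "f - 2"] card_C by auto
  \<comment> \<open>Otherwise \<open>C (f - 2)\<close> lies inside \<open>arc i f\<close>, whose
    share of \<open>X\<close> is only \<open>card (L \<inter> C f)\<close>, and \<open>X\<close>
    would have at most \<open>c + card T\<close> vertices.\<close>
  have fi: "f - 2 = i"
  proof (rule ccontr)
    assume "f - 2 \<noteq> i"
    then have "C (f - 2) \<subseteq> arc i f" using C_arc[of i "f - 2" f] f by simp
    then have "X \<inter> ?A \<union> X \<inter> C (f - 2) \<subseteq> X \<inter> arc i f" using AA' by blast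
    then have "card (X \<inter> ?A \<union> X \<inter> C (f - 2)) \<le> card (L \<inter> C f)" unfolding xA'[symmetric]
      by (rule card_mono[rotated]) (use fins in auto)
    moreover have "card (X \<inter> ?A \<union> X \<inter> C (f - 2)) = card (X \<inter> ?A) + card (X \<inter> C (f - 2))"
      by (rule card_Un_disjoint) (use fins hub_arc_disj[of f "f - 2"] w4 in \<open>auto simp: hub_def\<close>)
    ultimately show False using k1 cf xT kappa_eq c_pos by linarith
  qed
  have "card (X \<inter> ?A) \<le> card (L \<inter> C f)" unfolding xA'[symmetric] using AA' fins by (intro card_mono) auto
  \<comment> \<open>With this bound, all estimates entering the count \<open>k1\<close> are
    tight.\<close>
  then have "card (X \<inter> C (f - 2)) = c" "card (K \<inter> C f) = 0" using k1 cf xT x2 kappa_eq by linarith+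
  then have CiX: "C i \<subseteq> X" and KCf: "K \<inter> C f = {}"
    using card_seteq[of "C i" "X \<inter> C i"] fi fins card_C[of i] by auto
  have BK: "?B \<inter> K = {}"
  proof (rule ccontr)
    assume "?B \<inter> K \<noteq> {}"
    then have "card (L \<inter> ?U) \<le> card (X \<inter> ?B)" using cornerU[OF b sep_sym[OF sA] card_hub[OF fw(2,3)]] by blast
    then show False using XB LU fins(5) by simp
  qed
  have f2: "f = i + 2" "f - 1 = i + 1" using fi by auto
  have "arc (i + 1) (i + 3) = S (i + 1) \<union> C (i + 2) \<union> S (i + 2)" using arc_2[of "i + 1"] by (simp add: algebra_simps)
  moreover have "S (i + 2) \<subseteq> ?B" using S_arc[of f f "f - 2 + w"] f2(1) w4 by simp
  ultimately have "arc (i + 1) (i + 3) \<inter> K = {}" using S1K[unfolded f2(2)] KCf BK f2(1) by auto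
  moreover have "arc (i + 1) (i + 3) \<inter> L \<noteq> {}" using C_arc[of "i + 1" "i + 2" "i + 3"] LC f2(1) by auto
  moreover have "K \<inter> hub (i + 1) (i + 3) \<noteq> {}" using C1K[unfolded f2(2)] by (auto simp: hub_def)
  \<comment> \<open>\<open>C i\<close> returns as \<open>C (i + w)\<close>; the strict inequality
    \<open>i + 3 < i + w\<close> is where four hub sets are required.\<close>
  moreover have "C i \<subseteq> arc (i + 3) (i + 1 + w)" using C_arc[of "i + 3" "i + w" "i + 1 + w"] w4 C_per by simp
  then have "X \<inter> arc (i + 3) (i + 1 + w) \<noteq> {}" using CiX C_ne[of i] by blast
  moreover have "S i \<subseteq> arc (i + 3) (i + 1 + w)" using S_arc[of "i + 3" "i + w" "i + 1 + w"] w4 S_per by simp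
  then have "arc (i + 3) (i + 1 + w) \<inter> K \<noteq> {}" using SK S_ne[of i] by blast
  ultimately have "resolved X"
    using crossing_resolved[OF bal_sym[OF b], of "i + 3" "i + 1"] by simp
  then show False using nr by simp
qed

section \<open>Reversal of the orientation\<close>

text \<open>The sector between \<open>C (- k)\<close> and \<open>C (- (k + 1))\<close> is
  \<open>S (- k - 1)\<close>, whence the shift by one.\<close>

lemma reflection: "cyclic_wheel V E T (\<lambda>k. C (- k)) (\<lambda>k. S (- k - 1)) w c"
proof
  show "C (- (k mod w)) = C (- k)" for k
    using C_mod[of "- (k mod w)"] C_mod[of "- k"] by (simp add: mod_minus_eq)
  have "(- (k mod w) - 1) mod w = (- k - 1) mod w" for k
    by (metis mod_diff_left_eq mod_minus_eq)
  then show "S (- (k mod w) - 1) = S (- k - 1)" for k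
    using S_mod[of "- (k mod w) - 1"] S_mod[of "- k - 1"] by simp
  show "C (- i) \<inter> C (- j) = {}" if "\<not> w dvd i - j" for i j
    by (rule CC_dvd) (use that in \<open>simp add: dvd_diff_commute\<close>)
  show "S (- i - 1) \<inter> S (- j - 1) = {}" if "\<not> w dvd i - j" for i j
    by (rule SS_dvd) (use that in \<open>simp add: dvd_diff_commute\<close>)
  have "range (\<lambda>k. C (- k)) = range C"
  proof -
    have "C k \<in> range (\<lambda>k. C (- k))" for k by (rule range_eqI[of _ _ "- k"]) simp
    then show ?thesis by auto
  qed
  moreover have "range (\<lambda>k. S (- k - 1)) = range S"
  proof -
    have "S k \<in> range (\<lambda>k. S (- k - 1))" for k by (rule range_eqI[of _ _ "- k - 1"]) simp
    then show ?thesis by auto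
  qed
  ultimately show "V = T \<union> (\<Union>k. C (- k)) \<union> (\<Union>k. S (- k - 1))" using cover by simp
  show "y \<in> S (- k - 1) \<union> C (- k) \<union> C (- (k + 1)) \<union> T" if "x \<in> S (- k - 1)" "E x y" for x y k
    using S_nb[OF that] by auto
  show "y \<in> C (- (k - 1)) \<union> S (- (k - 1) - 1) \<union> C (- k) \<union> S (- k - 1) \<union> C (- (k + 1)) \<union> T"
    if "x \<in> C (- k)" "E x y" for x y k
  proof -
    have "- (k - 1) = - k + 1" "- (k - 1) - 1 = - k" "- (k + 1) = - k - 1" by auto
    then show ?thesis using C_nb[OF that] by auto
  qed
qed (use w4 C_ne S_ne TC TS CS card_C kappa_eq in auto)

text \<open>Read backwards, the last level of \<open>L\<close> becomes the first, so
  \<open>first_in_hub_set\<close> applies to the reflected wheel.\<close>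

lemma last_in_hub_set:
  assumes bs: "based K X L i" and g: "i + 1 < g" "g < i + w"
    and none: "arc g (i + w + 1) \<inter> L = {}" and LC: "L \<inter> C g \<noteq> {}"
  shows False
proof -
  interpret R: cyclic_wheel V E T "\<lambda>k. C (- k)" "\<lambda>k. S (- k - 1)" w c by (rule reflection)
  have arcR: "R.arc (- j) (- i) = arc i j" for i j
  proof -
    have "x \<in> R.arc (- j) (- i) \<longleftrightarrow> x \<in> arc i j" for x
    proof
      assume "x \<in> R.arc (- j) (- i)"
      then consider k where "- j \<le> k" "k < - i" "x \<in> S (- k - 1)" | k where "- j < k" "k < - i" "x \<in> C (- k)"
        by (auto simp: R.arc_def)
      then show "x \<in> arc i j"
      proof cases
        case 1 then show ?thesis using S_arc[of i "- k - 1" j] by auto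
      next
        case 2 then show ?thesis using C_arc[of i "- k" j] by auto
      qed
    next
      assume "x \<in> arc i j"
      then consider k where "i \<le> k" "k < j" "x \<in> S k" | k where "i < k" "k < j" "x \<in> C k"
        by (auto simp: arc_def)
      then show "x \<in> R.arc (- j) (- i)"
      proof cases
        case 1 then show ?thesis using R.S_arc[of "- j" "- k - 1" "- i"] by auto
      next
        case 2 then show ?thesis using R.C_arc[of "- j" "- k" "- i"] by auto
      qed
    qed
    then show ?thesis by blast
  qed
  have hubR: "R.hub (- j) (- i) = hub i j" for i j by (auto simp: R.hub_def hub_def)
  have hubR1: "R.hub k (k + 1) = hub (- k - 1) (- k - 1 + 1)" "R.hub k (k + 2) = hub (- k - 2) (- k - 2 + 2)" for k
    by (auto simp: R.hub_def hub_def)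
  have resR: "resolved X" if "R.resolved X"
    using that unfolding R.resolved_def resolved_def hubR1 by blast
  \<comment> \<open>Chosen so that \<open>- ?i - 1 = i + w\<close>: the reflected walk starts at the
    later copy of \<open>S i\<close> and descends to \<open>g\<close>.\<close>
  let ?i = "- (i + w) - 1"
  have "R.hub ?i (?i + 1) = hub (i + w) (i + w + 1)" using hubR[of "i + w + 1" "i + w"] by simp
  also have "\<dots> = hub i (i + 1)" using C_per[of i] C_per[of "i + 1"] by (simp add: hub_def add.commute add.left_commute)
  finally have hubi: "R.hub ?i (?i + 1) = hub i (i + 1)" .
  have Si: "S (- ?i - 1) = S i" using S_per[of i] by simp
  have "R.based K X L ?i"
    unfolding R.based_def hubi Si using bs resR unfolding based_def by blast
  moreover have "R.arc ?i (- g) = arc g (i + w + 1)" using arcR[of "i + w + 1" g] by simp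
  ultimately show False
    using R.first_in_hub_set[of K X L ?i "- g"] g none LC by simp
qed

text \<open>At the boundary between \<open>K\<close> and \<open>L\<close> near \<open>C k\<close>, the cut \<open>X\<close> uses either all of \<open>C k\<close> or only
  vertices of the adjacent sector \<open>S s\<close>.\<close>
definition end_at :: "'a set \<Rightarrow> 'a set \<Rightarrow> int \<Rightarrow> int \<Rightarrow> bool" where
  "end_at K X k s \<longleftrightarrow> X \<inter> S s = {} \<and> C k \<subseteq> X
     \<or> X \<inter> C k = {} \<and> C k \<subseteq> K \<and> card (X \<inter> S s) = c \<and> S s \<inter> K \<noteq> {}"

text \<open>\<open>k\<close> is the outer end of the sector, \<open>k'\<close> the one towards
  \<open>L\<close>. A sector missing \<open>K\<close> is pure and contains nothing of
  \<open>X\<close>; for one meeting \<open>K\<close>, the corner inequality and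
  \<open>C k' \<subseteq> L\<close> put \<open>c\<close> vertices of \<open>X\<close> into the
  sector.\<close>

lemma end_atI:
  assumes b: "bal K X L" and nr: "\<not> resolved X" and k: "k = s \<and> k' = s + 1 \<or> k = s + 1 \<and> k' = s"
    and LC: "L \<inter> C k = {}" and SL: "S s \<inter> L \<noteq> {}" and x: "card (X \<inter> S s) + card (X \<inter> C k) = c"
    and C': "C k' \<subseteq> L"
  shows "end_at K X k s"
proof (cases "S s \<inter> K = {}")
  case True
  have 0: "X \<inter> S s = {}" using pure_sector(1)[OF bal_sym[OF b] nr SL True] .
  then have "card (X \<inter> C k) = c" using x by simp
  then have "X \<inter> C k = C k" using card_C[of k] fins(2)[of k] by (intro card_seteq) auto
  then show ?thesis unfolding end_at_def using 0 by blast
next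
  case False
  have "C k' \<subseteq> L \<inter> hub s (s + 1)" using C' k by (auto simp: hub_def)
  then have "c \<le> card (L \<inter> hub s (s + 1))" unfolding card_C[of k', symmetric]
    by (rule card_mono[rotated]) (use fins in auto)
  also have "\<dots> \<le> card (X \<inter> S s)"
    using cornerU[OF b sector_sep _ False] card_hub[of s "s + 1"] w4 by simp
  finally have 1: "card (X \<inter> S s) = c" "card (X \<inter> C k) = 0" using x by auto
  then have 2: "X \<inter> C k = {}" using fins(2)[of k] by simp
  then have "C k \<subseteq> K" using bal_part[OF b subs(2)[of k]] LC by blast
  then show ?thesis unfolding end_at_def using 1 2 False by blast
qed

section \<open>Cuts concentrated at two ends\<close>

text \<open>The remaining configuration: \<open>L\<close> extends from \<open>S f\<close> to
  \<open>S g\<close>, and outside \<open>T\<close> the cut lives only at these two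
  boundaries.\<close>

definition two_ends :: "'a set \<Rightarrow> 'a set \<Rightarrow> 'a set \<Rightarrow> int \<Rightarrow> int \<Rightarrow> bool" where
  "two_ends K X L f g \<longleftrightarrow> bal K X L \<and> f < g \<and> g + 1 < f + w \<and> T \<subseteq> X
     \<and> X \<subseteq> S f \<union> C f \<union> T \<union> S g \<union> C (g + 1) \<and> C (f + 1) \<subseteq> L \<and> C g \<subseteq> L
     \<and> S f \<inter> L \<noteq> {} \<and> S g \<inter> L \<noteq> {} \<and> end_at K X f f \<and> end_at K X (g + 1) g"

text \<open>For each end sector the corner inequality demands at least \<open>c + card T\<close>
  vertices of \<open>X\<close> in the sector, its outer hub set and \<open>T\<close>. Both demands
  fit into \<open>\<kappa> = 2 * c + card T\<close> only with equality everywhere.\<close>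

lemma two_endsI:
  assumes b: "bal K X L" and nr: "\<not> resolved X" and LT: "L \<inter> T = {}"
    and fg: "f < g" "g + 1 < f + w"
    and Lf: "L \<inter> C f = {}" "S f \<inter> L \<noteq> {}" and Lg: "L \<inter> C (g + 1) = {}" "S g \<inter> L \<noteq> {}"
  shows "two_ends K X L f g"
proof -
  note d = balD[OF b]
  have sec: "\<kappa> \<le> card (X \<inter> S s) + card (X \<inter> C s) + card (X \<inter> T) + card (X \<inter> C (s + 1))
      + card (L \<inter> C s) + card (L \<inter> C (s + 1))" if "S s \<inter> L \<noteq> {}" for s
  proof -
    have s: "s < s + 1" "s + 1 < s + w" using w4 by auto
    show ?thesis
      using cornerX[OF bal_sym[OF b] sector_sep[of s] that] sep_card_split[OF sector_sep[of s] d(7)]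
        card_hub_Int[OF s, of X] card_hub_Int[OF s, of L] d(3) LT by simp
  qed
  have cC: "c = card (K \<inter> C k) + card (X \<inter> C k) + card (L \<inter> C k)" for k
    using bal_card[OF b subs(2)] card_C by simp
  have xT: "card (X \<inter> T) \<le> card T" using card_mono[OF fins(1), of "X \<inter> T"] by auto
  let ?l = "X \<inter> S f \<union> X \<inter> C f" and ?r = "X \<inter> S g \<union> X \<inter> C (g + 1)"
  have cl: "card ?l = card (X \<inter> S f) + card (X \<inter> C f)"
    by (rule card_Un_disjoint) (use fins CS[of f f] in auto)
  have cr: "card ?r = card (X \<inter> S g) + card (X \<inter> C (g + 1))"
    by (rule card_Un_disjoint) (use fins CS[of "g + 1" g] in auto)
  have "card (?l \<union> X \<inter> T) = card ?l + card (X \<inter> T)"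
    by (rule card_Un_disjoint) (use fins TC[of f] TS[of f] in auto)
  moreover have "card ((?l \<union> X \<inter> T) \<union> ?r) = card (?l \<union> X \<inter> T) + card ?r"
  proof (rule card_Un_disjoint)
    have "S f \<inter> S g = {}" "C f \<inter> C (g + 1) = {}" using SS[of f g] CC[of f "g + 1"] fg by auto
    then show "(?l \<union> X \<inter> T) \<inter> ?r = {}"
      using TC[of "g + 1"] TS[of g] CS[of f g] CS[of "g + 1" f] by blast
  qed (use fins in auto)
  ultimately have ct: "card ((?l \<union> X \<inter> T) \<union> ?r) = card ?l + card (X \<inter> T) + card ?r" by simp
  have tot: "card ?l + card (X \<inter> T) + card ?r \<le> \<kappa>"
    unfolding ct[symmetric] d(3)[symmetric] by (rule card_mono) (use d in auto)
  have l0: "card (L \<inter> C f) = 0" "card (L \<inter> C (g + 1)) = 0" using Lf Lg by simp_all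
  note sf = sec[OF Lf(2)] and sg = sec[OF Lg(2)]
  have eqs: "card ?l = c" "card ?r = c" "card (X \<inter> T) = card T"
    using sf sg cC[of "f + 1"] cC[of g] xT tot cl cr l0 kappa_eq by linarith+
  have "X \<subseteq> (?l \<union> X \<inter> T) \<union> ?r"
    using card_seteq[of X "(?l \<union> X \<inter> T) \<union> ?r"] d(3,10) ct eqs kappa_eq by fastforce
  then have Xsub: "X \<subseteq> S f \<union> C f \<union> T \<union> S g \<union> C (g + 1)" by blast
  have TX: "T \<subseteq> X" using card_seteq[of T "X \<inter> T"] eqs fins by auto
  \<comment> \<open>No hub set from \<open>f + 1\<close> to \<open>g\<close> contains any of
    \<open>X\<close>, so the tight counts place \<open>C (f + 1)\<close> and \<open>C g\<close> in
    \<open>L\<close>.\<close>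
  have X0: "X \<inter> C k = {}" if "f < k" "k \<le> g" for k
    using that Xsub CC[of f k] CC[of k "g + 1"] fg TC[of k] CS[of k f] CS[of k g] by fastforce
  then have "card (X \<inter> C (f + 1)) = 0" "card (X \<inter> C g) = 0" using fg by simp_all
  then have "card (L \<inter> C (f + 1)) = c" "card (L \<inter> C g) = c"
    using sf sg cC[of "f + 1"] cC[of g] cl cr l0 kappa_eq eqs by linarith+
  then have CL: "C (f + 1) \<subseteq> L" "C g \<subseteq> L"
    using card_seteq[of "C (f + 1)" "L \<inter> C (f + 1)"] card_seteq[of "C g" "L \<inter> C g"] fins card_C by auto
  have "end_at K X f f" using end_atI[OF b nr, of f f "f + 1"] Lf cl eqs CL by simp
  moreover have "end_at K X (g + 1) g" using end_atI[OF b nr, of "g + 1" g g] Lg cr eqs CL by simp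
  ultimately show ?thesis unfolding two_ends_def using b fg TX Xsub CL Lf Lg by blast
qed

text \<open>By \<open>first_in_hub_set\<close> and its mirror image, \<open>L\<close> begins and
  ends inside sectors; if these coincided, \<open>X\<close> would be laminar.\<close>

lemma based_two_ends:
  assumes bs: "based K X L i"
  shows "\<exists>f g. two_ends K X L f g"
proof -
  have b: "bal K X L" and nr: "\<not> resolved X" and SK: "S i \<subseteq> K" and Li: "L \<inter> hub i (i + 1) = {}"
    using bs by (auto simp: based_def)
  note d = balD[OF b]
  have LT: "L \<inter> T = {}" and LCi: "L \<inter> C i = {}" "L \<inter> C (i + 1) = {}" using Li by (auto simp: hub_def)
  have LSi: "L \<inter> S i = {}" using SK sep_disj[OF d(1)] by blast
  \<comment> \<open>\<open>F\<close> groups a sector with the hub set before it and \<open>G\<close>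
    with the one after it, so \<open>Min F\<close> and \<open>Max G\<close> locate the outermost
    levels of \<open>L\<close>.\<close>
  define F where "F = {k \<in> {i<..<i + w}. L \<inter> (C k \<union> S k) \<noteq> {}}"
  define G where "G = {k \<in> {i<..<i + w}. L \<inter> (S k \<union> C (k + 1)) \<noteq> {}}"
  have finFG: "finite F" "finite G" 
    by (rule finite_subset[of _ "{i<..<i + w}"]; auto simp: F_def G_def)+
  have "L \<noteq> {}" using d(1) by (auto simp: vsep_def)
  then obtain x where x: "x \<in> L" by blast
  then consider k where "x \<in> C k" | k where "x \<in> S k" using d(8) cover LT by blast
  then have "F \<noteq> {}"
  proof cases
    case 1
    then obtain k' where k': "k' \<in> {i..<i + w}" "x \<in> C k'" using C_window[of i k] by blast
    then have "k' \<noteq> i" using LCi x by blast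
    then have "k' \<in> F" using k' x by (auto simp: F_def)
    then show ?thesis by blast
  next
    case 2
    then obtain k' where k': "k' \<in> {i..<i + w}" "x \<in> S k'" using S_window[of i k] by blast
    then have "k' \<noteq> i" using LSi x by blast
    then have "k' \<in> F" using k' x by (auto simp: F_def)
    then show ?thesis by blast
  qed
  define f where "f = Min F"
  have fF: "f \<in> F" and fmin: "\<And>k. k \<in> F \<Longrightarrow> f \<le> k" using finFG \<open>F \<noteq> {}\<close> by (simp_all add: f_def)
  have f: "i < f" "f < i + w" using fF by (auto simp: F_def)
  have beforeF: "L \<inter> C k = {} \<and> L \<inter> S k = {}" if "i < k" "k < f" for k
  proof -
    have "k \<notin> F" using fmin[of k] that by auto
    then show ?thesis using that f by (auto simp: F_def)
  qed
  have Lf: "L \<inter> C f = {}"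
  proof (rule ccontr)
    assume a: "L \<inter> C f \<noteq> {}"
    then have "f \<noteq> i + 1" using LCi by blast
    moreover have "y \<notin> L" if y: "y \<in> arc i f" for y
    proof -
      consider k where "i \<le> k" "k < f" "y \<in> S k" | k where "i < k" "k < f" "y \<in> C k"
        using y by (auto simp: arc_def)
      then show ?thesis
      proof cases
        case 1 then show ?thesis using beforeF[of k] LSi by (cases "k = i") auto
      next
        case 2 then show ?thesis using beforeF[of k] by auto
      qed
    qed
    ultimately show False using first_in_hub_set[OF bs _ f(2) _ a] f(1) by fastforce
  qed
  then have Sf: "S f \<inter> L \<noteq> {}" using fF by (auto simp: F_def)
  then have fG: "f \<in> G" using f by (auto simp: G_def)
  define g where "g = Max G"
  have "G \<noteq> {}" using fG by blast
  then have gG: "g \<in> G" and gmax: "\<And>k. k \<in> G \<Longrightarrow> k \<le> g" using finFG by (simp_all add: g_def)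
  have g: "i < g" "g < i + w" using gG by (auto simp: G_def)
  have afterG: "L \<inter> S k = {} \<and> L \<inter> C (k + 1) = {}" if "g < k" "k < i + w" for k
  proof -
    have "k \<notin> G" using gmax[of k] that by auto
    then show ?thesis using that g by (auto simp: G_def)
  qed
  have Lg: "L \<inter> C (g + 1) = {}"
  proof (rule ccontr)
    assume a: "L \<inter> C (g + 1) \<noteq> {}"
    then have "g + 1 \<noteq> i + w" using LCi C_per by auto
    moreover have "y \<notin> L" if y: "y \<in> arc (g + 1) (i + w + 1)" for y
    proof -
      consider k where "g + 1 \<le> k" "k \<le> i + w" "y \<in> S k" | k where "g + 1 < k" "k \<le> i + w" "y \<in> C k"
        using y by (auto simp: arc_def)
      then show ?thesis
      proof cases
        case 1 then show ?thesis using afterG[of k] LSi S_per[of i] by (cases "k = i + w") auto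
      next
        case 2 then show ?thesis using afterG[of "k - 1"] LCi C_per[of i] by (cases "k = i + w") auto
      qed
    qed
    ultimately show False using last_in_hub_set[OF bs _ _ _ a] g by fastforce
  qed
  then have Sg: "S g \<inter> L \<noteq> {}" using gG by (auto simp: G_def)
  \<comment> \<open>For \<open>f = g\<close> the hub of \<open>S f\<close> would avoid
    \<open>L\<close>, and the corner inequality would leave nothing of \<open>X\<close> beyond that
    hub.\<close>
  have "f \<noteq> g"
  proof
    assume fg: "f = g"
    then have "L \<inter> hub f (f + 1) = {}" using Lf Lg LT by (auto simp: hub_def)
    then have "card (X \<inter> arc (f + 1) (f + w)) = 0"
      using cornerX[OF bal_sym[OF b] sector_sep[of f] Sf] by simp
    then have "X \<inter> arc (f + 1) (f + w) = {}" using fins(4)[of "f + 1" "f + w"] by simp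
    then have "X \<subseteq> hub f (f + 1) \<union> S f" using sep_mem[OF sector_sep[of f]] d(7) by blast
    then show False using nr by (auto simp: resolved_def)
  qed
  then have "f < g" "g + 1 < f + w" using gmax[OF fG] f g by auto
  then show ?thesis using two_endsI[OF b nr LT _ _ Lf Sf Lg Sg] by blast
qed

theorem balanced_cut_cases:
  assumes b: "bal K X L"
  shows "resolved X \<or> (\<exists>m. \<forall>a\<in>{m<..<m + w}. S a \<subseteq> X) \<or> (\<exists>K L f g. two_ends K X L f g)"
proof (cases "\<forall>a. S a \<inter> K \<noteq> {} \<longleftrightarrow> S a \<inter> L \<noteq> {}")
  case True
  then show ?thesis using no_pure_sector[OF b] by blast
next
  case False
  then obtain a where "S a \<inter> K \<noteq> {} \<and> S a \<inter> L = {} \<or> S a \<inter> L \<noteq> {} \<and> S a \<inter> K = {}" by blast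
  then show ?thesis
    using pure_sector_based[OF b, of a] pure_sector_based[OF bal_sym[OF b], of a] based_two_ends by blast
qed

section \<open>Insertion of a new hub set\<close>

text \<open>\<open>P\<close> faces \<open>C a\<close> and \<open>Q\<close> faces
  \<open>C (a + 1)\<close>; by the last condition no edge jumps over \<open>Y\<close>.\<close>

definition splits :: "int \<Rightarrow> 'a set \<Rightarrow> 'a set \<Rightarrow> 'a set \<Rightarrow> bool" where
  "splits a P Y Q \<longleftrightarrow> S a = P \<union> Y \<union> Q \<and> P \<inter> Y = {} \<and> P \<inter> Q = {} \<and> Y \<inter> Q = {} \<and> P \<noteq> {} \<and> Q \<noteq> {}
     \<and> card Y = c \<and> (\<forall>x\<in>P \<union> C a. \<forall>y\<in>Q \<union> C (a + 1). \<not> E x y)"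

text \<open>The inserted set \<open>Y\<close> gets index \<open>a + 1\<close> modulo \<open>w + 1\<close>; \<open>r\<close> counts the steps from it.\<close>
definition ins_C :: "int \<Rightarrow> 'a set \<Rightarrow> int \<Rightarrow> 'a set" where
  "ins_C a Y k = (let r = (k - a - 1) mod (w + 1) in if r = 0 then Y else C (a + r))"

text \<open>\<open>Q\<close> follows \<open>Y\<close>, and \<open>P\<close> sits at
  \<open>r = w\<close> because that is the place of \<open>C a\<close>, just before
  \<open>Y\<close>.\<close>

definition ins_S :: "int \<Rightarrow> 'a set \<Rightarrow> 'a set \<Rightarrow> int \<Rightarrow> 'a set" where
  "ins_S a P Q k = (let r = (k - a - 1) mod (w + 1) in if r = 0 then Q else if r = w then P else S (a + r))"

lemma ins_C_at: "0 \<le> r \<Longrightarrow> r \<le> w \<Longrightarrow> ins_C a Y (a + 1 + r) = (if r = 0 then Y else C (a + r))"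
  and ins_S_at: "0 \<le> r \<Longrightarrow> r \<le> w \<Longrightarrow> ins_S a P Q (a + 1 + r) = (if r = 0 then Q else if r = w then P else S (a + r))"
  by (simp_all add: ins_C_def ins_S_def)

lemma ins_C_low: "0 \<le> k \<Longrightarrow> k \<le> a \<Longrightarrow> a < w \<Longrightarrow> ins_C a Y k = C k"
  and ins_S_low: "0 \<le> k \<Longrightarrow> k < a \<Longrightarrow> a < w \<Longrightarrow> ins_S a P Q k = S k"
proof -
  have r: "(k - a - 1) mod (w + 1) = k - a + w" if "0 \<le> k" "k \<le> a" "a < w"
  proof -
    have "(k - a - 1) mod (w + 1) = (k - a - 1 + (w + 1)) mod (w + 1)" by (rule mod_add_self2[symmetric])
    also have "\<dots> = k - a + w" using that by (simp add: algebra_simps)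
    finally show ?thesis .
  qed
  show "ins_C a Y k = C k" if "0 \<le> k" "k \<le> a" "a < w"
    using r[OF that] that C_per[of k] by (simp add: ins_C_def Let_def)
  show "ins_S a P Q k = S k" if "0 \<le> k" "k < a" "a < w"
    using r that S_per[of k] by (simp add: ins_S_def Let_def)
qed

lemma ins_C_mid: "ins_C a Y (a + 1) = Y"
  by (simp add: ins_C_def)

lemma ins_C_high: "0 \<le> a \<Longrightarrow> a + 1 < k \<Longrightarrow> k \<le> w \<Longrightarrow> ins_C a Y k = C (k - 1)"
  using ins_C_at[of "k - a - 1" a Y] by simp

text \<open>In the local description only edges at the levels next to \<open>Y\<close> need a new
  check, and \<open>splits\<close> excludes those that jump over \<open>Y\<close>. The cuts of the
  larger wheel then come from \<open>arc_sep\<close>.\<close>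

lemma insertion:
  assumes sp: "splits a P Y Q"
  shows "cyclic_wheel V E T (ins_C a Y) (ins_S a P Q) (w + 1) c"
proof -
  have Sa: "S a = P \<union> Y \<union> Q" and dis: "P \<inter> Y = {}" "P \<inter> Q = {}" "Y \<inter> Q = {}"
    and ne: "P \<noteq> {}" "Q \<noteq> {}" and cY: "card Y = c"
    and nE: "\<And>x y. x \<in> P \<union> C a \<Longrightarrow> y \<in> Q \<union> C (a + 1) \<Longrightarrow> \<not> E x y"
    using sp unfolding splits_def by blast+
  have nE': "\<And>x y. x \<in> P \<union> C a \<Longrightarrow> y \<in> Q \<union> C (a + 1) \<Longrightarrow> \<not> E y x" using nE edge_sym by blast
  have Yne: "Y \<noteq> {}" using cY c_pos by auto
  have rep: "\<exists>r. 0 \<le> r \<and> r \<le> w \<and> ins_C a Y k = ins_C a Y (a + 1 + r) \<and> ins_S a P Q k = ins_S a P Q (a + 1 + r)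
      \<and> r = (k - a - 1) mod (w + 1)" for k
  proof (intro exI[of _ "(k - a - 1) mod (w + 1)"] conjI)
    show "(k - a - 1) mod (w + 1) \<le> w" "0 \<le> (k - a - 1) mod (w + 1)"
      using pos_mod_bound[of "w + 1" "k - a - 1"] w4 by auto
  qed (simp_all add: ins_C_def ins_S_def)
  have Cform: "\<exists>r. r = (k - a - 1) mod (w + 1) \<and> (r = 0 \<and> ins_C a Y k = Y \<or> 0 < r \<and> r \<le> w \<and> ins_C a Y k = C (a + r))" for k
    using rep[of k] ins_C_at by (metis order_le_less)
  have Sform: "\<exists>r. r = (k - a - 1) mod (w + 1) \<and> (r = 0 \<and> ins_S a P Q k = Q \<or> r = w \<and> ins_S a P Q k = P
      \<or> 0 < r \<and> r < w \<and> ins_S a P Q k = S (a + r))" for k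
    using rep[of k] ins_S_at[of _ a P Q] by (metis order_le_less)
  have Ssub: "S (a + r) \<inter> S a = {}" if "0 < r" "r < w" for r using SS[of a "a + r"] that by auto
  have C_in: "C k \<subseteq> (\<Union>k. ins_C a Y k)" for k
  proof -
    obtain k' where k': "k' \<in> {a + 1..<a + 1 + w}" "C k' = C k" using C_window by blast
    then have "ins_C a Y (k' + 1) = C k" using ins_C_at[of "k' - a" a Y] by (simp add: algebra_simps)
    then show ?thesis by blast
  qed
  have S_in: "S k \<subseteq> (\<Union>k. ins_C a Y k) \<union> (\<Union>k. ins_S a P Q k)" for k
  proof -
    obtain k' where k': "k' \<in> {a..<a + w}" "S k' = S k" using S_window by blast
    show ?thesis
    proof (cases "k' = a")
      case True
      have "ins_C a Y (a + 1 + 0) = Y" "ins_S a P Q (a + 1 + 0) = Q" "ins_S a P Q (a + 1 + w) = P"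
        using w4 by (simp_all only: ins_C_at ins_S_at) auto
      then have "S a \<subseteq> (\<Union>k. ins_C a Y k) \<union> (\<Union>k. ins_S a P Q k)" unfolding Sa by blast
      then show ?thesis using True k' by simp
    next
      case False
      then have "ins_S a P Q (k' + 1) = S k" using k' ins_S_at[of "k' - a" a P Q] by (simp add: algebra_simps)
      then show ?thesis by blast
    qed
  qed
  \<comment> \<open>\<open>r + 1\<close> and \<open>r - 1\<close> may leave the range from
    \<open>0\<close> to \<open>w\<close>; these values are evaluated in \<open>wrap\<close>.\<close>
  have shift: "ins_C a Y (k + 1) = ins_C a Y (a + 1 + (r + 1)) \<and> ins_C a Y (k - 1) = ins_C a Y (a + 1 + (r - 1))
      \<and> ins_S a P Q (k - 1) = ins_S a P Q (a + 1 + (r - 1))"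
    if "r = (k - a - 1) mod (w + 1)" for k r
  proof -
    have "(k + 1 - a - 1) mod (w + 1) = (r + 1) mod (w + 1)" "(k - 1 - a - 1) mod (w + 1) = (r - 1) mod (w + 1)"
      unfolding that by (simp_all add: mod_simps algebra_simps)
    then show ?thesis by (simp add: ins_C_def ins_S_def algebra_simps)
  qed
  have wrap: "ins_C a Y (a + 1 + (w + 1)) = Y" "ins_C a Y (a + 1 + (0 - 1)) = C a" "ins_S a P Q (a + 1 + (0 - 1)) = P"
  proof -
    have "(- 1) mod (w + 1) = w" "(1 + w) mod (w + 1) = 0" using w4 by (simp_all add: zmod_minus1 add.commute)
    then show "ins_C a Y (a + 1 + (w + 1)) = Y" "ins_C a Y (a + 1 + (0 - 1)) = C a" "ins_S a P Q (a + 1 + (0 - 1)) = P"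
      using w4 C_per[of a] by (simp_all add: ins_C_def ins_S_def)
  qed
  show ?thesis
  proof
    show "4 \<le> w + 1" using w4 by simp
    have m: "(k mod (w + 1) - a - 1) mod (w + 1) = (k - a - 1) mod (w + 1)" for k by (metis mod_diff_left_eq)
    show "ins_C a Y (k mod (w + 1)) = ins_C a Y k" "ins_S a P Q (k mod (w + 1)) = ins_S a P Q k" for k
      by (simp_all only: ins_C_def ins_S_def m)
    show "ins_C a Y k \<noteq> {}" for k using Cform[of k] C_ne Yne by metis
    show "ins_S a P Q k \<noteq> {}" for k using Sform[of k] S_ne ne by metis
    show "T \<inter> ins_C a Y k = {}" for k using Cform[of k] TC TS[of a] Sa by fastforce
    show "T \<inter> ins_S a P Q k = {}" for k using Sform[of k] TS TS[of a] Sa by fastforce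
    show "ins_C a Y j \<inter> ins_S a P Q k = {}" for j k
    proof -
      obtain r where r: "r = 0 \<and> ins_C a Y j = Y \<or> 0 < r \<and> r \<le> w \<and> ins_C a Y j = C (a + r)" using Cform by blast
      obtain q where "q = 0 \<and> ins_S a P Q k = Q \<or> q = w \<and> ins_S a P Q k = P
        \<or> 0 < q \<and> q < w \<and> ins_S a P Q k = S (a + q)" using Sform by blast
      then show ?thesis using r dis CS[of "a + r" a] CS[of "a + r" "a + q"] Ssub[of q] Sa by auto
    qed
    show "ins_C a Y i \<inter> ins_C a Y j = {}" if nd: "\<not> w + 1 dvd i - j" for i j
    proof -
      obtain r where r: "r = (i - a - 1) mod (w + 1)"
        "r = 0 \<and> ins_C a Y i = Y \<or> 0 < r \<and> r \<le> w \<and> ins_C a Y i = C (a + r)" using Cform by blast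
      obtain q where q: "q = (j - a - 1) mod (w + 1)"
        "q = 0 \<and> ins_C a Y j = Y \<or> 0 < q \<and> q \<le> w \<and> ins_C a Y j = C (a + q)" using Cform by blast
      have "r \<noteq> q" using nd unfolding r(1) q(1) by (simp add: mod_eq_dvd_iff)
      moreover have "C (a + r) \<inter> C (a + q) = {}" if "0 < r" "r \<le> w" "0 < q" "q \<le> w"
        using that \<open>r \<noteq> q\<close> CC[of "a + r" "a + q"] CC[of "a + q" "a + r"] by (cases "r < q") auto
      ultimately show ?thesis using r q CS[of "a + r" a] CS[of "a + q" a] Sa by auto
    qed
    show "ins_S a P Q i \<inter> ins_S a P Q j = {}" if nd: "\<not> w + 1 dvd i - j" for i j
    proof -
      obtain r where r: "r = (i - a - 1) mod (w + 1)" "r = 0 \<and> ins_S a P Q i = Q \<or> r = w \<and> ins_S a P Q i = P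
        \<or> 0 < r \<and> r < w \<and> ins_S a P Q i = S (a + r)" using Sform by blast
      obtain q where q: "q = (j - a - 1) mod (w + 1)" "q = 0 \<and> ins_S a P Q j = Q \<or> q = w \<and> ins_S a P Q j = P
        \<or> 0 < q \<and> q < w \<and> ins_S a P Q j = S (a + q)" using Sform by blast
      have "r \<noteq> q" using nd unfolding r(1) q(1) by (simp add: mod_eq_dvd_iff)
      moreover have "S (a + r) \<inter> S (a + q) = {}" if "0 < r" "r < w" "0 < q" "q < w"
        using that \<open>r \<noteq> q\<close> SS[of "a + r" "a + q"] SS[of "a + q" "a + r"] by (cases "r < q") auto
      ultimately show ?thesis using r(2) q(2) Ssub[of r] Ssub[of q] Sa dis by auto
    qed
    show "V = T \<union> (\<Union>k. ins_C a Y k) \<union> (\<Union>k. ins_S a P Q k)"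
    proof
      show "V \<subseteq> T \<union> (\<Union>k. ins_C a Y k) \<union> (\<Union>k. ins_S a P Q k)" (is "_ \<subseteq> ?R")
      proof
        fix x assume "x \<in> V"
        then consider "x \<in> T" | k where "x \<in> C k" | k where "x \<in> S k" using cover by blast
        then show "x \<in> ?R"
        proof cases
          case 2 then show ?thesis using C_in[of k] by blast
        next
          case 3 then show ?thesis using S_in[of k] by blast
        qed simp
      qed
      have "Y \<subseteq> V" "P \<subseteq> V" "Q \<subseteq> V" using subs(3)[of a] Sa by auto
      then have "ins_C a Y k \<subseteq> V" "ins_S a P Q k \<subseteq> V" for k
        using Cform[of k] Sform[of k] subs(2,3) by metis+
      then show "T \<union> (\<Union>k. ins_C a Y k) \<union> (\<Union>k. ins_S a P Q k) \<subseteq> V" using subs(1) by blast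
    qed
    show "y \<in> ins_S a P Q k \<union> ins_C a Y k \<union> ins_C a Y (k + 1) \<union> T" if x: "x \<in> ins_S a P Q k" and e: "E x y" for x y k
    proof -
      obtain r where r: "0 \<le> r" "r \<le> w" "ins_C a Y k = ins_C a Y (a + 1 + r)"
        "ins_S a P Q k = ins_S a P Q (a + 1 + r)" "r = (k - a - 1) mod (w + 1)" using rep by blast
      note sh = shift[OF r(5)]
      consider "r = 0" | "r = w" | "0 < r" "r < w" using r by linarith
      then show ?thesis
      proof cases
        case 1
        then have k: "ins_S a P Q k = Q" "ins_C a Y k = Y" "ins_C a Y (k + 1) = C (a + 1)"
          using r sh ins_S_at[of 0 a P Q] ins_C_at[of 0 a Y] ins_C_at[of 1 a Y] w4 by simp_all
        then have "y \<in> S a \<union> C a \<union> C (a + 1) \<union> T" using S_nb[of x a y] x e Sa by auto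
        moreover have "y \<notin> P \<union> C a" using nE' x k e by blast
        ultimately show ?thesis unfolding k using Sa by blast
      next
        case 2
        then have k: "ins_S a P Q k = P" "ins_C a Y k = C a" "ins_C a Y (k + 1) = Y"
          using r sh ins_S_at[of w a P Q] ins_C_at[of w a Y] wrap w4 C_per by simp_all
        then have "y \<in> S a \<union> C a \<union> C (a + 1) \<union> T" using S_nb[of x a y] x e Sa by auto
        moreover have "y \<notin> Q \<union> C (a + 1)" using nE x k e by blast
        ultimately show ?thesis unfolding k using Sa by blast
      next
        case 3
        then have k: "ins_S a P Q k = S (a + r)" "ins_C a Y k = C (a + r)" "ins_C a Y (k + 1) = C (a + r + 1)"
          using r sh ins_S_at[of r a P Q] ins_C_at[of r a Y] ins_C_at[of "r + 1" a Y] by (simp_all add: add.assoc)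
        then show ?thesis using S_nb[of x "a + r" y] x e by simp
      qed
    qed
    show "y \<in> ins_C a Y (k - 1) \<union> ins_S a P Q (k - 1) \<union> ins_C a Y k \<union> ins_S a P Q k \<union> ins_C a Y (k + 1) \<union> T"
      if x: "x \<in> ins_C a Y k" and e: "E x y" for x y k
    proof -
      obtain r where r: "0 \<le> r" "r \<le> w" "ins_C a Y k = ins_C a Y (a + 1 + r)"
        "ins_S a P Q k = ins_S a P Q (a + 1 + r)" "r = (k - a - 1) mod (w + 1)" using rep by blast
      note sh = shift[OF r(5)]
      \<comment> \<open>In order: \<open>Y\<close> itself, \<open>C (a + 1)\<close> after it,
        \<open>C a\<close> before it, and hub sets whose surroundings are unchanged.\<close>
      consider "r = 0" | "r = 1" | "r = w" | "1 < r" "r < w" using r by linarith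
      then show ?thesis
      proof cases
        case 1
        then have k: "ins_S a P Q k = Q" "ins_C a Y k = Y" "ins_C a Y (k + 1) = C (a + 1)"
          "ins_C a Y (k - 1) = C a" "ins_S a P Q (k - 1) = P"
          using r sh ins_S_at[of 0 a P Q] ins_C_at[of 0 a Y] ins_C_at[of 1 a Y] wrap w4 by simp_all
        then have "y \<in> S a \<union> C a \<union> C (a + 1) \<union> T" using S_nb[of x a y] x e Sa by auto
        then show ?thesis unfolding k Sa by blast
      next
        case 2
        then have k: "ins_S a P Q k = S (a + 1)" "ins_C a Y k = C (a + 1)" "ins_C a Y (k + 1) = C (a + 2)"
          "ins_C a Y (k - 1) = Y" "ins_S a P Q (k - 1) = Q"
          using r sh ins_S_at[of 0 a P Q] ins_S_at[of 1 a P Q] ins_C_at[of 0 a Y] ins_C_at[of 1 a Y] ins_C_at[of 2 a Y] w4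
          by simp_all
        then have "y \<in> C a \<union> S a \<union> C (a + 1) \<union> S (a + 1) \<union> C (a + 2) \<union> T"
          using C_nb[of x "a + 1" y] x e by (simp add: add.assoc)
        moreover have "y \<notin> P \<union> C a" using nE' x k e by blast
        ultimately show ?thesis unfolding k using Sa by blast
      next
        case 3
        have "a + (w - 1) = a - 1 + w" by simp
        then have pe: "C (a + (w - 1)) = C (a - 1)" "S (a + (w - 1)) = S (a - 1)" using C_per S_per by metis+
        then have k: "ins_S a P Q k = P" "ins_C a Y k = C a" "ins_C a Y (k + 1) = Y"
          "ins_C a Y (k - 1) = C (a - 1)" "ins_S a P Q (k - 1) = S (a - 1)"
          using 3 r sh ins_S_at[of w a P Q] ins_S_at[of "w - 1" a P Q] ins_C_at[of w a Y] ins_C_at[of "w - 1" a Y]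
            wrap w4 C_per by simp_all
        then have "y \<in> C (a - 1) \<union> S (a - 1) \<union> C a \<union> S a \<union> C (a + 1) \<union> T" using C_nb[of x a y] x e by simp
        moreover have "y \<notin> Q \<union> C (a + 1)" using nE x k e by blast
        ultimately show ?thesis unfolding k using Sa by blast
      next
        case 4
        then have k: "ins_S a P Q k = S (a + r)" "ins_C a Y k = C (a + r)" "ins_C a Y (k + 1) = C (a + r + 1)"
          "ins_C a Y (k - 1) = C (a + r - 1)" "ins_S a P Q (k - 1) = S (a + r - 1)"
          using r sh ins_S_at[of r a P Q] ins_S_at[of "r - 1" a P Q] ins_C_at[of r a Y] ins_C_at[of "r - 1" a Y]
            ins_C_at[of "r + 1" a Y] by (simp_all add: add.assoc diff_add_eq[symmetric] add_diff_eq)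
        then show ?thesis using C_nb[of x "a + r" y] x e by simp
      qed
    qed
    show "card (ins_C a Y k) = c" for k using Cform[of k] cY card_C by metis
  qed (rule kappa_eq)
qed

section \<open>From cyclic indices back to lists\<close>

lemma forms_wheel_list:
  assumes len: "int (length Cs) = w" and nth: "\<And>k. k < length Cs \<Longrightarrow> Cs ! k = C (int k)"
  shows "forms_wheel V E T Cs"
proof -
  let ?n = "length Cs"
  define Ss where "Ss = map (\<lambda>k. S (int k)) [0..<?n]"
  have lS: "length Ss = ?n" and nthS: "\<And>k. k < ?n \<Longrightarrow> Ss ! k = S (int k)" by (simp_all add: Ss_def)
  have Cm: "Cs ! ((i + m) mod ?n) = C (int i + int m)" and Sm: "Ss ! ((i + m) mod ?n) = S (int i + int m)" for i m
  proof -
    have "(i + m) mod ?n < ?n" using len w4 by (intro mod_less_divisor) linarith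
    moreover have "int ((i + m) mod ?n) = (int i + int m) mod w" unfolding len[symmetric] by (simp add: zmod_int)
    ultimately show "Cs ! ((i + m) mod ?n) = C (int i + int m)" "Ss ! ((i + m) mod ?n) = S (int i + int m)"
      using nth nthS C_mod[of "int i + int m"] S_mod[of "int i + int m"] by simp_all
  qed
  have "C k \<in> set Cs" for k
  proof -
    obtain k' where k': "k' \<in> {0..<0 + w}" "C k' = C k" using C_window by blast
    then have "nat k' < ?n" using len by auto
    then show ?thesis using nth[of "nat k'"] nth_mem[of "nat k'" Cs] k' by auto
  qed
  moreover have "S k \<in> set Ss" for k
  proof -
    obtain k' where k': "k' \<in> {0..<0 + w}" "S k' = S k" using S_window by blast
    then have "nat k' < ?n" using len by auto
    then show ?thesis using nthS[of "nat k'"] nth_mem[of "nat k'" Ss] lS k' by auto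
  qed
  ultimately have "set Cs = range C" "set Ss = range S"
    using nth by (auto simp: in_set_conv_nth Ss_def)
  then have cov: "T \<union> \<Union>(set Cs) \<union> \<Union>(set Ss) = V" using cover by simp
  have dis: "Cs ! i \<inter> Cs ! j = {} \<and> Ss ! i \<inter> Ss ! j = {}" if "i < ?n" "j < ?n" "i \<noteq> j" for i j
  proof (cases "i < j")
    case True
    then have "int i < int j" "int j < int i + w" using that len by auto
    then show ?thesis using that nth nthS CC SS by simp
  next
    case False
    then have "int j < int i" "int i < int j + w" using that len by auto
    then have "C (int j) \<inter> C (int i) = {}" "S (int j) \<inter> S (int i) = {}" using CC SS by auto
    then show ?thesis using that nth nthS by auto
  qed
  have cut: "kappa_cut V E (Cs ! i \<union> T \<union> Cs ! ((i + 2) mod ?n))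
      \<and> disconnects V E (Cs ! i \<union> T \<union> Cs ! ((i + 2) mod ?n)) (Ss ! i \<union> Cs ! ((i + 1) mod ?n) \<union> Ss ! ((i + 1) mod ?n))"
    if "i < ?n" for i
  proof -
    have i: "int i < int i + 2" "int i + 2 < int i + w" using w4 by auto
    have "Cs ! i \<union> T \<union> Cs ! ((i + 2) mod ?n) = hub (int i) (int i + 2)"
      "Ss ! i \<union> Cs ! ((i + 1) mod ?n) \<union> Ss ! ((i + 1) mod ?n) = arc (int i) (int i + 2)"
      using that Cm[of i 2] Cm[of i 1] Sm[of i 1] nth nthS by (simp_all add: hub_def arc_2)
    then show ?thesis
      using sep_kappa_cut[OF arc_sep[OF i] card_hub[OF i]] sep_disconnects[OF arc_sep[OF i]] by simp
  qed
  have "4 \<le> ?n" using len w4 by linarith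
  then have "wheel_with_sectors V E T Cs Ss"
    unfolding wheel_with_sectors_def Let_def
    using lS cov dis cut nth nthS C_ne S_ne TC TS CS by simp
  then show ?thesis unfolding forms_wheel_def by blast
qed

lemma forms_wheel_insert:
  assumes len: "int (length Cs) = w" and nth: "\<And>k. k < length Cs \<Longrightarrow> Cs ! k = C (int k)"
    and i: "i < length Cs" and sp: "splits (int i) P Y Q"
  defines "Cs' \<equiv> take (i + 1) Cs @ [Y] @ drop (i + 1) Cs"
  shows "length Cs' = length Cs + 1" "\<And>k. k < length Cs' \<Longrightarrow> Cs' ! k = ins_C (int i) Y (int k)"
    "forms_wheel V E T Cs'"
proof -
  interpret I: cyclic_wheel V E T "ins_C (int i) Y" "ins_S (int i) P Q" "w + 1" c
    by (rule insertion[OF sp])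
  show l: "length Cs' = length Cs + 1" using i by (simp add: Cs'_def)
  show n: "Cs' ! k = ins_C (int i) Y (int k)" if k: "k < length Cs'" for k
  proof -
    consider "k \<le> i" | "k = i + 1" | "i + 1 < k" by linarith
    then show ?thesis
    proof cases
      case 1
      then show ?thesis using ins_C_low[of "int k" "int i" Y] i len nth[of k] by (simp add: Cs'_def nth_append)
    next
      case 2
      then show ?thesis using ins_C_mid[of "int i" Y] i by (simp add: Cs'_def nth_append add.commute)
    next
      case 3
      then have "ins_C (int i) Y (int k) = C (int k - 1)" using ins_C_high[of "int i" "int k" Y] k l len by simp
      moreover have "Cs' ! k = Cs ! (k - 1)"
      proof -
        have "Suc (k - 2) = k - 1" using 3 by simp
        then show ?thesis using 3 i by (simp add: Cs'_def nth_append nth_Cons')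
      qed
      ultimately show ?thesis using nth[of "k - 1"] k l 3 by (simp add: of_nat_diff)
    qed
  qed
  show "forms_wheel V E T Cs'" by (rule I.forms_wheel_list) (use l n len in auto)
qed

text \<open>The later position is filled first: positions up to \<open>j\<close> keep their index,
  so the split of sector \<open>i\<close> remains valid in the enlarged wheel.\<close>

lemma forms_wheel_insert_twice:
  assumes len: "int (length Cs) = w" and nth: "\<And>k. k < length Cs \<Longrightarrow> Cs ! k = C (int k)"
    and ij: "i < j" "j < length Cs" and sp: "splits (int i) P Y Q" and sp': "splits (int j) P' Y' Q'"
  shows "forms_wheel V E T (take (i + 1) Cs @ [Y] @ take (j - i) (drop (i + 1) Cs) @ [Y'] @ drop (j + 1) Cs)"
proof -
  let ?Cs = "take (j + 1) Cs @ [Y'] @ drop (j + 1) Cs"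
  interpret I: cyclic_wheel V E T "ins_C (int j) Y'" "ins_S (int j) P' Q'" "w + 1" c
    by (rule insertion[OF sp'])
  note ins = forms_wheel_insert[OF len nth ij(2) sp']
  have jw: "int j < w" using ij len by simp
  have "I.splits (int i) P Y Q"
    using sp ins_S_low[of "int i" "int j"] ins_C_low[of "int i" "int j"] ins_C_low[of "int i + 1" "int j"] ij jw
    unfolding I.splits_def splits_def by simp
  then have "forms_wheel V E T (take (i + 1) ?Cs @ [Y] @ drop (i + 1) ?Cs)"
    by (intro I.forms_wheel_insert(3)) (use ins ij len in auto)
  moreover have "take (i + 1) ?Cs = take (i + 1) Cs"
    "drop (i + 1) ?Cs = take (j - i) (drop (i + 1) Cs) @ [Y'] @ drop (j + 1) Cs"
    using ij by (simp_all add: drop_take min_def)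
  ultimately show ?thesis by (simp only: append_assoc)
qed

lemma splits_mod: "splits a P Y Q \<Longrightarrow> splits (a mod w) P Y Q"
proof -
  have "C (a mod w + 1) = C (a + 1)"
    using C_mod[of "a mod w + 1"] C_mod[of "a + 1"] by (simp add: mod_add_left_eq)
  then show "splits a P Y Q \<Longrightarrow> splits (a mod w) P Y Q" by (simp add: splits_def S_mod C_mod)
qed

lemma splitsI:
  assumes b: "bal K X L" and "C a \<subseteq> K" "C (a + 1) \<subseteq> L" "card (X \<inter> S a) = c" "S a \<inter> K \<noteq> {}" "S a \<inter> L \<noteq> {}"
  shows "splits a (S a \<inter> K) (X \<inter> S a) (S a \<inter> L)"
proof -
  have "S a = S a \<inter> K \<union> X \<inter> S a \<union> S a \<inter> L" using bal_part[OF b subs(3)[of a]] by blast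
  moreover have "\<not> E x y" if "x \<in> S a \<inter> K \<union> C a" "y \<in> S a \<inter> L \<union> C (a + 1)" for x y
    using that assms(2,3) sep_no_edge[OF balD(1)[OF b]] by blast
  moreover have "K \<inter> X = {}" "K \<inter> L = {}" "X \<inter> L = {}" using sep_disj[OF balD(1)[OF b]] by auto
  ultimately show ?thesis using assms(4-6) unfolding splits_def by blast
qed

text \<open>Each end of \<open>X\<close> is a whole hub set or splits its sector; the four
  combinations yield a hub, one insertion at either end, or two insertions.\<close>

lemma two_ends_outcome:
  assumes te: "two_ends K X L f g"
  shows "(\<exists>i j. \<not> w dvd i - j \<and> X = hub i j)
     \<or> (\<exists>i j P Q. \<not> w dvd i - j \<and> splits i P (X \<inter> S i) Q \<and> X \<subseteq> S i \<union> T \<union> C j)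
     \<or> (\<exists>i j P Q P' Q'. \<not> w dvd i - j \<and> splits i P (X \<inter> S i) Q \<and> splits j P' (X \<inter> S j) Q'
          \<and> X \<subseteq> S i \<union> T \<union> S j)"
proof -
  have b: "bal K X L" and fg: "f < g" "g + 1 < f + w" and TX: "T \<subseteq> X"
    and Xs: "X \<subseteq> S f \<union> C f \<union> T \<union> S g \<union> C (g + 1)" and CL: "C (f + 1) \<subseteq> L" "C g \<subseteq> L"
    and SL: "S f \<inter> L \<noteq> {}" "S g \<inter> L \<noteq> {}" and ends: "end_at K X f f" "end_at K X (g + 1) g"
    using te by (auto simp: two_ends_def)
  have nd: "\<not> w dvd f - (g + 1)" "\<not> w dvd f - g" using window_dvd[of f "g + 1"] window_dvd[of f g] fg by auto
  have nd': "\<not> w dvd g - f" using nd(2) by (simp add: dvd_diff_commute)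
  have l: "X \<inter> S f = {} \<and> C f \<subseteq> X \<or> X \<inter> C f = {} \<and> (\<exists>P Q. splits f P (X \<inter> S f) Q)"
    using ends(1) splitsI[OF b _ CL(1) _ _ SL(1)] unfolding end_at_def by blast
  \<comment> \<open>At the far end \<open>C g\<close> lies in \<open>L\<close> and
    \<open>C (g + 1)\<close> towards \<open>K\<close>, so the split is taken with \<open>K\<close>
    and \<open>L\<close> exchanged.\<close>
  have r: "X \<inter> S g = {} \<and> C (g + 1) \<subseteq> X \<or> X \<inter> C (g + 1) = {} \<and> (\<exists>P Q. splits g P (X \<inter> S g) Q)"
    using ends(2) splitsI[OF bal_sym[OF b] CL(2) _ _ SL(2)] unfolding end_at_def by blast
  consider "X \<inter> S f = {}" "C f \<subseteq> X" "X \<inter> S g = {}" "C (g + 1) \<subseteq> X"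
    | P Q where "X \<inter> S f = {}" "X \<inter> C (g + 1) = {}" "splits g P (X \<inter> S g) Q"
    | P Q where "X \<inter> C f = {}" "X \<inter> S g = {}" "splits f P (X \<inter> S f) Q"
    | P Q P' Q' where "X \<inter> C f = {}" "X \<inter> C (g + 1) = {}" "splits f P (X \<inter> S f) Q" "splits g P' (X \<inter> S g) Q'"
    using l r by blast
  then show ?thesis
  proof cases
    case 1
    then have "X = hub f (g + 1)" using Xs TX unfolding hub_def by blast
    then show ?thesis using nd(1) by blast
  next
    case 2
    then have "X \<subseteq> S g \<union> T \<union> C f" using Xs by blast
    then show ?thesis using nd' 2(3) by blast
  next
    case 3
    then have "X \<subseteq> S f \<union> T \<union> C (g + 1)" using Xs by blast
    then show ?thesis using nd(1) 3(3) by blast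
  next
    case 4
    then have "X \<subseteq> S f \<union> T \<union> S g" using Xs by blast
    then show ?thesis using nd(2) 4(3,4) by blast
  qed
qed

end

section \<open>Wheels given by lists\<close>

lemma nat_mod_add: "0 < n \<Longrightarrow> nat ((k + int m) mod int n) = (nat (k mod int n) + m) mod n"
proof -
  assume "0 < n"
  then have "int ((nat (k mod int n) + m) mod n) = (k + int m) mod int n"
    by (simp add: zmod_int mod_add_left_eq)
  then show ?thesis by linarith
qed

context sgraph
begin

text \<open>\<open>S k\<close> belongs to the parts cut off at \<open>k - 1\<close> and at
  \<open>k\<close>; intersecting the two resulting bounds on its neighbours leaves only
  \<open>S k\<close>, \<open>C k\<close>, \<open>C (k + 1)\<close> and \<open>T\<close>.\<close>

lemma wheel_cyclic:
  assumes wh: "wheel_with_sectors V E T Cs Ss"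
  defines "w \<equiv> int (length Cs)"
  shows "\<exists>c. cyclic_wheel V E T (\<lambda>k. Cs ! nat (k mod w)) (\<lambda>k. Ss ! nat (k mod w)) w c"
proof -
  let ?n = "length Cs"
  define C where "C k = Cs ! nat (k mod w)" for k
  define S where "S k = Ss ! nat (k mod w)" for k
  note W = wh[unfolded wheel_with_sectors_def Let_def]
  have lS: "length Ss = ?n" and n4: "4 \<le> ?n" using W by simp_all
  have ne: "Cs ! i \<noteq> {} \<and> Ss ! i \<noteq> {}" if "i < ?n" for i
    using W that by (elim conjE) simp
  have cov: "T \<union> \<Union>(set Cs) \<union> \<Union>(set Ss) = V" using W by (elim conjE)
  have Td: "T \<inter> Cs ! i = {} \<and> T \<inter> Ss ! i = {}" if "i < ?n" for i
    using W that by (elim conjE) simp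
  have dis: "Cs ! i \<inter> Cs ! j = {} \<and> Ss ! i \<inter> Ss ! j = {}" if "i < ?n" "j < ?n" "i \<noteq> j" for i j
    using W that by (elim conjE) simp
  have CSd: "Cs ! i \<inter> Ss ! j = {}" if "i < ?n" "j < ?n" for i j
    using W that by (elim conjE) simp
  have cut: "kappa_cut V E (Cs ! i \<union> T \<union> Cs ! ((i + 2) mod ?n))
       \<and> disconnects V E (Cs ! i \<union> T \<union> Cs ! ((i + 2) mod ?n)) (Ss ! i \<union> Cs ! ((i + 1) mod ?n) \<union> Ss ! ((i + 1) mod ?n))"
    if "i < ?n" for i
    using W that by (elim conjE) simp
  have n0: "0 < ?n" using n4 by linarith
  have w4: "4 \<le> w" using n4 by (simp add: w_def)
  have idx: "nat (k mod w) < ?n" for k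
    using pos_mod_bound[of w k] pos_mod_sign[of w k] w4 unfolding w_def by linarith
  have cutI: "kappa_cut V E (C k \<union> T \<union> C (k + 2))"
    "sep (S k \<union> C (k + 1) \<union> S (k + 1)) (C k \<union> T \<union> C (k + 2)) (V - (C k \<union> T \<union> C (k + 2) \<union> (S k \<union> C (k + 1) \<union> S (k + 1))))" for k
  proof -
    have e: "C (k + 2) = Cs ! ((nat (k mod w) + 2) mod ?n)" "C (k + 1) = Cs ! ((nat (k mod w) + 1) mod ?n)"
      "S (k + 1) = Ss ! ((nat (k mod w) + 1) mod ?n)"
      using nat_mod_add[OF n0, of k 2] nat_mod_add[OF n0, of k 1] by (simp_all add: C_def S_def w_def)
    note c = cut[OF idx[of k], folded e, folded C_def S_def]
    show "kappa_cut V E (C k \<union> T \<union> C (k + 2))" using c by blast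
    then have "C k \<union> T \<union> C (k + 2) \<subseteq> V" by (simp add: kappa_cut_def is_cut_def)
    then show "sep (S k \<union> C (k + 1) \<union> S (k + 1)) (C k \<union> T \<union> C (k + 2)) (V - (C k \<union> T \<union> C (k + 2) \<union> (S k \<union> C (k + 1) \<union> S (k + 1))))"
      using disconnects_sep c by blast
  qed
  have nb: "y \<in> S k \<union> C (k + 1) \<union> S (k + 1) \<union> (C k \<union> T \<union> C (k + 2))"
    if "x \<in> S k \<union> C (k + 1) \<union> S (k + 1)" "E x y" for x y k
    using sep_no_edge[OF cutI(2)[of k] that(1), of y] that(2) edge_in[OF that(2)] by blast
  have dvd: "nat (i mod w) \<noteq> nat (j mod w)" if "\<not> w dvd i - j" for i j
    using that w4 by (simp add: nat_eq_iff mod_eq_dvd_iff)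
  have CCd: "C i \<inter> C j = {}" and SSd: "S i \<inter> S j = {}" if "\<not> w dvd i - j" for i j
    using dis[OF idx idx dvd[OF that]] by (auto simp: C_def S_def)
  \<comment> \<open>Indices \<open>k - 1\<close> and \<open>k + 2\<close> differ modulo
    \<open>w\<close> because \<open>w\<close> is at least 4; without this the two bounds could
    overlap in a further hub set.\<close>
  have small: "\<not> w dvd (k + 2) - (k - 1)" "\<not> w dvd (k + 1) - (k - 1)" for k
    using w4 zdvd_not_zless[of 3 w] zdvd_not_zless[of 2 w] by simp_all
  have CSd': "C i \<inter> S j = {}" for i j using CSd[OF idx idx] by (simp add: C_def S_def)
  have Td': "T \<inter> C i = {}" "T \<inter> S i = {}" for i using Td[OF idx] by (auto simp: C_def S_def)
  interpret L: cyclic_levels V E T C S w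
  proof
    show "4 \<le> w" by (rule w4)
    show "C (k mod w) = C k" "S (k mod w) = S k" for k by (simp_all add: C_def S_def)
    show "C k \<noteq> {}" "S k \<noteq> {}" for k using ne[OF idx[of k]] by (auto simp: C_def S_def)
    show "V = T \<union> (\<Union>k. C k) \<union> (\<Union>k. S k)"
    proof -
      have "Cs ! i = C (int i)" "Ss ! i = S (int i)" if "i < ?n" for i using that by (simp_all add: C_def S_def w_def)
      then have "set Cs \<subseteq> range C" "set Ss \<subseteq> range S" using lS by (auto simp: in_set_conv_nth)
      moreover have "range C \<subseteq> set Cs" "range S \<subseteq> set Ss" using idx lS by (auto simp: C_def S_def)
      ultimately have "set Cs = range C" "set Ss = range S" by auto
      then show ?thesis using cov by simp
    qed
    show "y \<in> S k \<union> C k \<union> C (k + 1) \<union> T" if x: "x \<in> S k" and e: "E x y" for x y k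
    proof -
      have 1: "y \<in> S k \<union> C (k + 1) \<union> S (k + 1) \<union> (C k \<union> T \<union> C (k + 2))" using nb[of x k y] x e by blast
      have "y \<in> S (k - 1) \<union> C (k - 1 + 1) \<union> S (k - 1 + 1) \<union> (C (k - 1) \<union> T \<union> C (k - 1 + 2))"
        using nb[of x "k - 1" y] x e by simp
      moreover have "k - 1 + 2 = k + 1" by simp
      ultimately have "y \<in> S (k - 1) \<union> C k \<union> S k \<union> (C (k - 1) \<union> T \<union> C (k + 1))" by simp
      then show ?thesis using 1 CCd[OF small(1)[of k]] SSd[OF small(2)[of k]] CSd'[of "k + 2" "k - 1"] CSd'[of "k - 1" "k + 1"] by blast
    qed
    show "y \<in> C (k - 1) \<union> S (k - 1) \<union> C k \<union> S k \<union> C (k + 1) \<union> T" if x: "x \<in> C k" and e: "E x y" for x y k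
    proof -
      have "y \<in> S (k - 1) \<union> C (k - 1 + 1) \<union> S (k - 1 + 1) \<union> (C (k - 1) \<union> T \<union> C (k - 1 + 2))"
        using nb[of x "k - 1" y] x e by simp
      moreover have "k - 1 + 2 = k + 1" by simp
      ultimately show ?thesis by auto
    qed
  qed (use CCd SSd CSd' Td' in auto)
  have "card (L.hub i (i + 2)) = kappa V E" for i using cutI(1)[of i] by (simp add: L.hub_def kappa_cut_def)
  note cc = L.card_C_constant[OF this]
  have "cyclic_wheel V E T C S w (card (C 0))"
    by unfold_locales (use cc in auto)
  then show ?thesis unfolding C_def S_def by blast
qed

end

section \<open>Assembly of the alternatives\<close>

theorem theorem3:
  fixes V :: "'a set" and E :: "'a \<Rightarrow> 'a \<Rightarrow> bool"
    and T X :: "'a set" and Cs Ss :: "'a set list"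
  assumes graph: "simple_graph V E"
    and conn: "graph_connected V E"
    and noncomp: "non_complete V E"
    and kappa_small: "4 * kappa V E < card V"
    and wheel: "wheel_with_sectors V E T Cs Ss"
    and X: "kappa_cut V E X"
  shows "(\<exists>i<length Cs. \<exists>j<length Cs. i \<noteq> j \<and> X = Cij T Cs i j)
       \<or> (\<exists>i<length Cs. X \<subseteq> Cij T Cs i (i + 1) \<union> Ss ! i)
       \<or> (\<exists>i<length Cs. \<exists>U\<in>{Cij T Cs i (i + 1), Cij T Cs i (i + 2)}.
             card (sides V E U) = 2 \<and>
             (\<exists>A P. A \<in> sides V E U \<and> P \<noteq> {} \<and> P \<subseteq> U \<and> crossing_matching_cut V E U A P X))
       \<or> I_small V E X (kappa V E - 1)
       \<or> small_wheel Ss (kappa V E)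
       \<or> (\<exists>i j. i < j \<and> j < length Cs \<and> X \<subseteq> Ss ! i \<union> T \<union> Ss ! j
            \<and> forms_wheel V E T
                (take (i + 1) Cs @ [X \<inter> Ss ! i] @ take (j - i) (drop (i + 1) Cs)
                  @ [X \<inter> Ss ! j] @ drop (j + 1) Cs))
       \<or> (\<exists>i<length Cs. \<exists>j<length Cs. i \<noteq> j \<and> X \<subseteq> Ss ! i \<union> T \<union> Cs ! j
            \<and> forms_wheel V E T (take (i + 1) Cs @ [X \<inter> Ss ! i] @ drop (i + 1) Cs))"
    (is "?c1 \<or> ?c2 \<or> ?c3 \<or> ?c4 \<or> ?c5 \<or> ?c6 \<or> ?c7")
proof (cases ?c4)
  case True
  then show ?thesis by - (rule disjI2, rule disjI2, rule disjI2, rule disjI1)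
next
  case ns: False
  interpret sgraph V E
    using graph by unfold_locales (auto simp: simple_graph_def)
  let ?n = "length Cs"
  define w where "w = int ?n"
  define C where "C k = Cs ! nat (k mod w)" for k
  define S where "S k = Ss ! nat (k mod w)" for k
  obtain c where "cyclic_wheel V E T C S w c"
    using wheel_cyclic[OF wheel] unfolding C_def S_def w_def by blast
  then interpret cyclic_wheel V E T C S w c .
  have lS: "length Ss = ?n" using wheel by (simp add: wheel_with_sectors_def Let_def)
  have len: "int (length Cs) = w" by (simp add: w_def)
  have n0: "0 < ?n" using len w4 by linarith
  have nth: "Cs ! k = C (int k)" "Ss ! k = S (int k)" if "k < ?n" for k
    using that by (simp_all add: C_def S_def w_def)
  define ix where "ix k = nat (k mod w)" for k
  have ixn: "ix k < ?n" and ixw: "int (ix k) = k mod w" for k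
    using pos_mod_bound[of w k] pos_mod_sign[of w k] w4 unfolding ix_def w_def by linarith+
  have Cix: "Cs ! ix k = C k" and Six: "Ss ! ix k = S k" for k by (simp_all add: C_def S_def ix_def)
  have ixm: "(ix k + m) mod ?n = ix (k + int m)" for k m
    using nat_mod_add[OF n0, of k m] by (simp add: ix_def w_def)
  have ixd: "ix i \<noteq> ix j" if "\<not> w dvd i - j" for i j
    using that ixw[of i] ixw[of j] by (metis mod_eq_dvd_iff)
  have Cij: "Cij T Cs (ix k) (ix k + m) = hub k (k + int m)" for k m
    using ixm[of k m] Cix ixn[of k] by (simp add: Cij_def hub_def)
  have pos: "\<kappa> > 0" using kappa_eq c_pos by simp
  \<comment> \<open>Here \<open>\<kappa> < n/4\<close> and the failure of smallness enter.\<close>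
  obtain K L where b: "bal K X L"
    using not_I_small_balanced[OF _ _ kappa_small ns pos] X unfolding kappa_cut_def bal_def by blast
  from balanced_cut_cases[OF b] consider "resolved X" | m where "\<forall>a\<in>{m<..<m + w}. S a \<subseteq> X"
    | K L f g where "two_ends K X L f g" by blast
  then show ?thesis
  proof cases
    case 1
    then consider k where "X \<subseteq> hub k (k + 1) \<union> S k"
      | k U A P where "U = hub k (k + 1) \<or> U = hub k (k + 2)" "crossing_matching_cut V E U A P X"
      unfolding resolved_def by blast
    then show ?thesis
    proof cases
      case 1
      then have "X \<subseteq> Cij T Cs (ix k) (ix k + 1) \<union> Ss ! ix k" using Cij[of k 1] Six by simp
      with ixn have ?c2 by (intro exI[of _ "ix k"] conjI)
      then show ?thesis by - (rule disjI2, rule disjI1)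
    next
      case 2
      then have "U \<in> {Cij T Cs (ix k) (ix k + 1), Cij T Cs (ix k) (ix k + 2)}"
        using Cij[of k 1] Cij[of k 2] by auto
      moreover have "card (sides V E U) = 2" "A \<in> sides V E U" "P \<noteq> {}" "P \<subseteq> U"
        using 2(2) unfolding crossing_matching_cut_def by (elim exE conjE; simp)+
      ultimately have ?c3 using 2(2) ixn
        by (intro exI[of _ "ix k"] conjI bexI[of _ U] exI[of _ A] exI[of _ P])
      then show ?thesis by - (rule disjI2, rule disjI2, rule disjI1)
    qed
  next
    case 2
    \<comment> \<open>All sectors except the one at \<open>ix m\<close> lie in \<open>X\<close> and
      are disjoint, so their sizes add up to at most \<open>\<kappa>\<close>.\<close>
    let ?I = "{..<length Ss} - {ix m}"
    have sub: "Ss ! i \<subseteq> X" if i: "i \<in> ?I" for i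
    proof -
      obtain k where k: "k \<in> {m..<m + w}" "S k = S (int i)" using S_window by blast
      have "k \<noteq> m"
      proof
        assume "k = m"
        then have "S (int (ix m)) = S (int i)" using k(2) ixw S_mod by simp
        moreover have "S (int (ix m)) \<inter> S (int i) = {}"
          using SS[of "int (ix m)" "int i"] SS[of "int i" "int (ix m)"] i ixn[of m] lS len
          by (cases "ix m < i") auto
        ultimately show False using S_ne by simp
      qed
      then have "k \<in> {m<..<m + w}" using k(1) by auto
      then have "S k \<subseteq> X" using 2 by blast
      then show ?thesis using k nth(2)[of i] i lS by simp
    qed
    have "(\<Sum>i\<in>?I. card (Ss ! i)) = card (\<Union>i\<in>?I. Ss ! i)"
    proof (rule card_UN_disjoint[symmetric])
      show "\<forall>i\<in>?I. finite (Ss ! i)" using nth(2) lS fins by simp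
      show "\<forall>i\<in>?I. \<forall>j\<in>?I. i \<noteq> j \<longrightarrow> Ss ! i \<inter> Ss ! j = {}"
        using wheel lS by (simp add: wheel_with_sectors_def Let_def)
    qed simp
    also have "\<dots> \<le> card X" by (rule card_mono) (use sub balD(10)[OF b] in auto)
    finally have ?c5 unfolding small_wheel_def using balD(3)[OF b] ixn[of m] lS by auto
    then show ?thesis by - (rule disjI2, rule disjI2, rule disjI2, rule disjI2, rule disjI1)
  next
    case 3
    consider
      i j where "\<not> w dvd i - j" "X = hub i j"
      | i j P Q where "\<not> w dvd i - j" "splits i P (X \<inter> S i) Q" "X \<subseteq> S i \<union> T \<union> C j"
      | i j P Q P' Q' where "\<not> w dvd i - j" "splits i P (X \<inter> S i) Q" "splits j P' (X \<inter> S j) Q'"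
        "X \<subseteq> S i \<union> T \<union> S j" using two_ends_outcome[OF 3] by (elim disjE exE conjE)
    then show ?thesis
    proof cases
      case 1
      have "X = Cij T Cs (ix i) (ix j)" using 1(2) Cix ixn by (simp add: Cij_def hub_def)
      with ixd[OF 1(1)] ixn have ?c1 by (intro exI[of _ "ix i"] exI[of _ "ix j"] conjI)
      then show ?thesis by - (rule disjI1)
    next
      case 2
      have "splits (int (ix i)) P (X \<inter> Ss ! ix i) Q" using splits_mod[OF 2(2)] ixw Six by simp
      from forms_wheel_insert(3)[OF len nth(1) ixn this]
      have ?c7 using ixd[OF 2(1)] ixn 2(3) Cix Six by (intro exI[of _ "ix i"] conjI exI[of _ "ix j"]) simp_all
      then show ?thesis by - (rule disjI2, rule disjI2, rule disjI2, rule disjI2, rule disjI2, rule disjI2)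
    next
      case 3
      \<comment> \<open>Stated for general positions, because \<open>ix i\<close> and
        \<open>ix j\<close> may come in either order.\<close>
      have ins: ?c6 if "a < b'" "b' < ?n" "splits (int a) P1 (X \<inter> Ss ! a) Q1"
        "splits (int b') P2 (X \<inter> Ss ! b') Q2" "X \<subseteq> Ss ! a \<union> T \<union> Ss ! b'" for a b' P1 Q1 P2 Q2
        using forms_wheel_insert_twice[OF len nth(1) that(1-4)] that
        by (intro exI[of _ a] exI[of _ b'] conjI)
      have s: "splits (int (ix i)) P (X \<inter> Ss ! ix i) Q" "splits (int (ix j)) P' (X \<inter> Ss ! ix j) Q'"
        using splits_mod[OF 3(2)] splits_mod[OF 3(3)] ixw Six by simp_all
      have x: "X \<subseteq> Ss ! ix i \<union> T \<union> Ss ! ix j" "X \<subseteq> Ss ! ix j \<union> T \<union> Ss ! ix i" using 3(4) Six by auto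
      consider "ix i < ix j" | "ix j < ix i" using ixd[OF 3(1)] by linarith
      then have ?c6
      proof cases
        case 1 then show ?thesis by (rule ins[OF _ ixn s x(1)])
      next
        case 2 then show ?thesis by (rule ins[OF _ ixn s(2) s(1) x(2)])
      qed
      then show ?thesis by - (rule disjI2, rule disjI2, rule disjI2, rule disjI2, rule disjI2, rule disjI1)
    qed
  qed
qed

end
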